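(* Let $n\ge 1$ and let $K,L\subseteq\mathbb{R}^n$ be convex bodies with $0\in\mathrm{int}\,K\cap\mathrm{int}\,L$ such that $K^\circ$ and $L^\circ$ have opposite barycenters, i.e. $\frac{1}{|K^\circ|}\int_{K^\circ}x\,dx=-\frac{1}{|L^\circ|}\int_{L^\circ}x\,dx$. Then $$ |(K\cap L)^\circ|\,|(K-L)^\circ|\geq\binom{2n}{n}^{-1}|K^\circ|\,|L^\circ|. $$ In particular (the case $L=K$), if $K\subseteq\mathbb{R}^n$ is a convex body with $0\in\mathrm{int}\,K$ such that $K^\circ$ has barycenter at the origin, then $$ |(K-K)^\circ|\geq\binom{2n}{n}^{-1}|K^\circ|. $$
   Context: A convex body in $\mathbb{R}^n$ is a convex compact set with non-empty interior; $|\cdot|$ is Lebesgue measure; $K-L=\{x-y:x\in K,\ y\in L\}$. For a convex body $K$ with $0\in\mathrm{int}\,K$, the polar body is $K^\circ=\{x\in\mathbb{R}^n:\langle x,y\rangle\le 1\ \forall y\in K\}$. *)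

theory Defs
  imports "HOL-Analysis.Analysis"
begin

definition convex_body :: "'a::euclidean_space set \<Rightarrow> bool" where
  "convex_body K \<longleftrightarrow> convex K \<and> compact K \<and> interior K \<noteq> {}"

definition polar :: "'a::euclidean_space set \<Rightarrow> 'a set" where
  "polar K = {x. \<forall>y\<in>K. x \<bullet> y \<le> 1}"

(* Not to be confused with the library's minus on sets, which is the set-theoretic difference. *)
definition minkowski_diff :: "'a::euclidean_space set \<Rightarrow> 'a set \<Rightarrow> 'a set" where
  "minkowski_diff K L = {x - y | x y. x \<in> K \<and> y \<in> L}"

(* Meaningful only if A has positive finite measure and the identity is integrable on A, as is the
   case when A is a convex body, in particular the polar of a convex body K with 0 in its interior. *)
definition barycenter :: "'a::euclidean_space set \<Rightarrow> 'a" where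
  "barycenter A = (1 / measure lebesgue A) *\<^sub>R (LINT x:A|lebesgue. x)"

end

(* Write A and B for the polars of K and L, with gauges p and q (the support functions of K and L).
   The body W = {(x, y). p x + q y <= 1}, the convex hull of A x 0 and 0 x B, has volume
   |A| |B| / binomial(2n, n). The map (x, y) -> x + y sends W into the polar of the intersection of
   K and L, and its fiber over 0 is the polar of K - L. Let h z be the volume of the fiber over z.
   By Brunn-Minkowski h is log-concave, hence h z (1 - v . z) <= h 0 for some v. The barycenter
   hypothesis says that the barycenter of h is 0, so integrating this inequality over the polar of
   the intersection gives |W| <= h 0 |polar of the intersection|.
   Brunn-Minkowski is derived from the Prekopa-Leindler inequality, by induction on the set of
   coordinates. *)
theory Submission
  imports Defs
begin

section \<open>The Prekopa-Leindler inequality\<close>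

text \<open>Let n be the dimension. The barycenter hypothesis works through a coincidence of
  constants. Slicing W over A splits its first moment in direction v into two integrals of different
  shape: (v . x) (1 - p x)^n, and (1 - p x)^(n+1). Both carry the same Beta factor n! (n+1)! /
  (2n+1)!. The moment is therefore a multiple of |A| |B| v . (bar A + bar B), and opposite
  barycenters annihilate it for every v at once. This is needed because v is not explicit: nothing
  is known about a derivative of h at 0, so v comes from a separating hyperplane. The factor 1 /
  binomial(2n, n) = n! n! / (2n)! is the Beta factor of the integral of (1 - p x)^n over A.
  Brunn-Minkowski goes through functions because the functional inequality passes to marginals and
  so to products of lines, while the marginal of a set is no longer a set.\<close>

lemma lmeasurable_affine:
  fixes S :: "'a::euclidean_space set"
  assumes S: "S \<in> lmeasurable" and m: "m \<noteq> 0"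
  shows "(\<lambda>x. m *\<^sub>R x + c) ` S \<in> lmeasurable"
proof -
  have "(\<lambda>x. m *\<^sub>R x) ` S = (\<lambda>x. (1 / m) *\<^sub>R x) -` S \<inter> space lebesgue"
  proof safe
    fix x assume "(1 / m) *\<^sub>R x \<in> S"
    then have "m *\<^sub>R ((1 / m) *\<^sub>R x) \<in> (\<lambda>x. m *\<^sub>R x) ` S" by blast
    with m show "x \<in> (\<lambda>x. m *\<^sub>R x) ` S" by simp
  qed (use m in auto)
  also have "\<dots> \<in> sets lebesgue"
    using S by (intro measurable_sets[OF lebesgue_measurable_scaling]) auto
  finally have "(\<lambda>x. m *\<^sub>R x) ` S \<in> lmeasurable"
    using S emeasure_lebesgue_affine[of m 0 S]
    by (intro fmeasurableI) (auto simp: fmeasurable_def ennreal_mult_less_top)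
  from measurable_translation[OF this, of c] show ?thesis
    by (simp add: image_image add.commute)
qed

text \<open>On the line, suitable translates of \<open>(1 - t) A\<close> and \<open>t B\<close> are
  almost disjoint inside \<open>C\<close>, so their measures add. \<open>Sup A\<close> and
  \<open>Inf B\<close> need not be attained, which costs an \<open>e\<close>. \<open>C\<close> is
  any Borel superset of the combination, since a Minkowski combination of Borel sets need not be
  Borel.\<close>

lemma brunn_minkowski_real:
  fixes A B C :: "real set" and t :: real
  assumes A: "A \<in> sets borel" "bounded A" "A \<noteq> {}"
    and B: "B \<in> sets borel" "bounded B" "B \<noteq> {}"
    and C: "C \<in> sets borel"
    and t: "0 < t" "t < 1"
    and sub: "\<And>a b. a \<in> A \<Longrightarrow> b \<in> B \<Longrightarrow> (1 - t) * a + t * b \<in> C"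
  shows "ennreal (1 - t) * emeasure lborel A + ennreal t * emeasure lborel B \<le> emeasure lborel C"
proof (cases "emeasure lborel C = \<infinity>")
  case False
  define m where "m = measure (lebesgue :: real measure)"
  have Alm: "A \<in> lmeasurable" and Blm: "B \<in> lmeasurable"
    using A B by (auto intro: bounded_set_imp_lmeasurable)
  have Clm: "C \<in> lmeasurable"
    using C False by (intro fmeasurableI) (auto simp: top.not_eq_extremum)
  have bdd: "bdd_above A" "bdd_below B"
    using A B by (auto intro: bounded_imp_bdd_above bounded_imp_bdd_below)
  have eps: "(1 - t) * m A + t * m B \<le> m C + e" if e: "e > 0" for e
  proof -
    obtain a where a: "a \<in> A" "Sup A - e < a"
      using less_cSup_iff[OF A(3) bdd(1), of "Sup A - e"] e by auto
    obtain b where b: "b \<in> B" "b < Inf B + e"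
      using cInf_less_iff[OF B(3) bdd(2), of "Inf B + e"] e by auto
    define A' B' where "A' = A \<inter> {..a}" and "B' = B \<inter> {b..}"
    have lm: "A' \<in> lmeasurable" "B' \<in> lmeasurable"
      unfolding A'_def B'_def using Alm Blm by (auto intro: fmeasurable_Int_fmeasurable)
    have "m A \<le> m (A' \<union> {a..Sup A})"
      unfolding m_def using Alm lm cSup_upper[OF _ bdd(1)]
      by (intro measure_mono_fmeasurable fmeasurable.Un) (auto simp: A'_def not_le less_imp_le)
    also have "\<dots> \<le> m A' + m {a..Sup A}"
      unfolding m_def using lm by (intro measure_Un_le) auto
    also have "m {a..Sup A} \<le> e"
      unfolding m_def using a e cSup_upper[OF a(1) bdd(1)] by simp
    finally have mA: "m A \<le> m A' + e" by simp
    have "m B \<le> m (B' \<union> {Inf B..b})"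
      unfolding m_def using Blm lm cInf_lower[OF _ bdd(2)]
      by (intro measure_mono_fmeasurable fmeasurable.Un) (auto simp: B'_def not_le less_imp_le)
    also have "\<dots> \<le> m B' + m {Inf B..b}"
      unfolding m_def using lm by (intro measure_Un_le) auto
    also have "m {Inf B..b} \<le> e"
      unfolding m_def using b e cInf_lower[OF b(1) bdd(2)] by simp
    finally have mB: "m B \<le> m B' + e" by simp
    \<comment> \<open>\<open>X\<close> moves through \<open>A'\<close> with \<open>b\<close> fixed,
      \<open>Y\<close> through \<open>B'\<close> with \<open>a\<close> fixed. As \<open>A'\<close>
      lies below \<open>a\<close> and \<open>B'\<close> above \<open>b\<close>, the point
      \<open>(1 - t) * a + t * b\<close> separates them.\<close>
    define X Y where "X = (\<lambda>x. (1 - t) *\<^sub>R x + t * b) ` A'" and "Y = (\<lambda>y. t *\<^sub>R y + (1 - t) * a) ` B'"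
    have XY: "X \<in> lmeasurable" "Y \<in> lmeasurable"
      "m X = (1 - t) * m A'" "m Y = t * m B'"
      unfolding X_def Y_def m_def using t
      by (simp_all add: lmeasurable_affine[OF lm(1), of "1 - t" "t * b", simplified] lmeasurable_affine[OF lm(2), of t "(1 - t) * a", simplified]
        measure_lebesgue_affine[of "1 - t" "t * b" A', simplified] measure_lebesgue_affine[of t "(1 - t) * a" B', simplified])
    have "X \<inter> Y \<subseteq> {(1 - t) * a + t * b}"
    proof
      fix z assume z: "z \<in> X \<inter> Y"
      then obtain x where x: "z = (1 - t) * x + t * b" "x \<le> a"
        by (auto simp: X_def A'_def)
      from z obtain y where y: "z = t * y + (1 - t) * a" "y \<ge> b"
        by (auto simp: Y_def B'_def)
      from x t have "z \<le> (1 - t) * a + t * b" by simp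
      moreover from y t have "z \<ge> (1 - t) * a + t * b" by simp
      ultimately show "z \<in> {(1 - t) * a + t * b}" by simp
    qed
    then have "negligible (X \<inter> Y)"
      by (rule negligible_subset[OF negligible_sing])
    then have "m (X \<union> Y) = m X + m Y"
      unfolding m_def using XY measure_Un3[of X lebesgue Y]
      by (simp add: negligible_imp_measure0)
    moreover have "m (X \<union> Y) \<le> m C"
    proof -
      have "X \<union> Y \<subseteq> C"
        using sub a(1) b(1) by (auto simp: X_def Y_def A'_def B'_def add.commute)
      then show ?thesis
        unfolding m_def using XY Clm by (intro measure_mono_fmeasurable) auto
    qed
    ultimately have "(1 - t) * m A' + t * m B' \<le> m C" using XY by simp
    moreover have "(1 - t) * m A \<le> (1 - t) * (m A' + e)" "t * m B \<le> t * (m B' + e)"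
      using mA mB t by (auto intro: mult_left_mono)
    ultimately show ?thesis by (simp add: algebra_simps)
  qed
  have "(1 - t) * m A + t * m B \<le> m C"
    by (rule field_le_epsilon) (rule eps)
  moreover have "emeasure lborel S = ennreal (m S)" if "S \<in> lmeasurable" "S \<in> sets borel" for S
    using that emeasure_eq_measure2[of S lebesgue] by (simp add: m_def fmeasurable_def)
  moreover have "m A \<ge> 0" "m B \<ge> 0" by (simp_all add: m_def)
  ultimately show ?thesis
    using Alm Blm Clm A(1) B(1) C t
    by (simp add: ennreal_leI flip: ennreal_mult ennreal_plus)
qed auto

text \<open>Tonelli on the region under the graph. The half-open interval \<open>{0..<f x}\<close>
  produces strict superlevel sets, and \<open>f x \<le> 1\<close> empties the levels from 1
  on.\<close>

lemma nn_integral_layer_cake: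
  fixes f :: "real \<Rightarrow> real"
  assumes [measurable]: "f \<in> borel_measurable borel" and f: "\<And>x. 0 \<le> f x" "\<And>x. f x \<le> 1"
  shows "(\<integral>\<^sup>+x. f x \<partial>lborel) = (\<integral>\<^sup>+s\<in>{0..<1}. emeasure lborel {x. s < f x} \<partial>lborel)"
proof -
  have "(\<integral>\<^sup>+x. f x \<partial>lborel) = (\<integral>\<^sup>+x. emeasure lborel {0..<f x} \<partial>lborel)"
    using f by simp
  also have "\<dots> = (\<integral>\<^sup>+x. (\<integral>\<^sup>+s. indicator {0..<f x} s \<partial>lborel) \<partial>lborel)"
    by simp
  also have "\<dots> = (\<integral>\<^sup>+x. (\<integral>\<^sup>+s. indicator {p. 0 \<le> snd p \<and> snd p < f (fst p)} (x, s) \<partial>lborel) \<partial>lborel)"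
    by (intro nn_integral_cong) (auto simp: indicator_def)
  also have "\<dots> = (\<integral>\<^sup>+s. (\<integral>\<^sup>+x. indicator {p. 0 \<le> snd p \<and> snd p < f (fst p)} (x, s) \<partial>lborel) \<partial>lborel)"
    by (rule lborel_pair.Fubini'[symmetric]) (simp add: case_prod_unfold)
  also have "\<dots> = (\<integral>\<^sup>+s\<in>{0..<1}. emeasure lborel {x. s < f x} \<partial>lborel)"
  proof (intro nn_integral_cong)
    fix s :: real
    have "(\<integral>\<^sup>+x. indicator {p. 0 \<le> snd p \<and> snd p < f (fst p)} (x, s) \<partial>lborel)
      = (\<integral>\<^sup>+x. indicator {0..<1} s * indicator {x. s < f x} x \<partial>lborel)"
      using f(2) by (intro nn_integral_cong) (auto simp: indicator_def dest: less_le_trans)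
    also have "\<dots> = indicator {0..<1} s * emeasure lborel {x. s < f x}"
      by (simp add: nn_integral_cmult)
    finally show "(\<integral>\<^sup>+x. indicator {p. 0 \<le> snd p \<and> snd p < f (fst p)} (x, s) \<partial>lborel)
      = emeasure lborel {x. s < f x} * indicator {0..<1} s"
      by (simp add: mult.commute)
  qed
  finally show ?thesis .
qed

text \<open>With both suprema equal to 1, the superlevel sets of \<open>f\<close> and
  \<open>g\<close> are nonempty at every level below 1, so the inequality for sets applies level by
  level. The result bounds the arithmetic mean, which is stronger than the geometric one.\<close>

lemma prekopa_leindler_normalized:
  fixes f g h :: "real \<Rightarrow> real" and t R :: real
  assumes [measurable]: "f \<in> borel_measurable borel" "g \<in> borel_measurable borel" "h \<in> borel_measurable borel"
    and nonneg: "\<And>x. 0 \<le> f x" "\<And>x. 0 \<le> g x" "\<And>x. 0 \<le> h x"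
    and sup: "\<And>x. f x \<le> 1" "\<And>x. g x \<le> 1" "\<And>s. s < 1 \<Longrightarrow> \<exists>x. s < f x" "\<And>s. s < 1 \<Longrightarrow> \<exists>x. s < g x"
    and supp: "\<And>x. f x \<noteq> 0 \<Longrightarrow> \<bar>x\<bar> \<le> R" "\<And>x. g x \<noteq> 0 \<Longrightarrow> \<bar>x\<bar> \<le> R"
    and t: "0 < t" "t < 1"
    and le: "\<And>x y. min (f x) (g y) \<le> h ((1 - t) * x + t * y)"
  shows "ennreal (1 - t) * (\<integral>\<^sup>+x. f x \<partial>lborel) + ennreal t * (\<integral>\<^sup>+x. g x \<partial>lborel) \<le> (\<integral>\<^sup>+x. h x \<partial>lborel)"
proof -
  \<comment> \<open>Truncation opens the layer cake formula to \<open>h\<close> and preserves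
    \<open>le\<close>, because \<open>f\<close> is at most 1.\<close>
  define h' where "h' x = min (h x) 1" for x
  have [measurable]: "h' \<in> borel_measurable borel" unfolding h'_def by measurable
  have le': "min (f x) (g y) \<le> h' ((1 - t) * x + t * y)" for x y
    using le[of x y] sup(1)[of x] by (simp add: h'_def min_le_iff_disj)
  have meas: "(\<lambda>s. emeasure lborel {x. s < u x}) \<in> borel_measurable borel"
    if [measurable]: "u \<in> borel_measurable borel" for u :: "real \<Rightarrow> real"
  proof -
    have "(\<lambda>s. \<integral>\<^sup>+x. indicator {p. fst p < u (snd p)} (s, x) \<partial>lborel) \<in> borel_measurable borel"
      by (rule lborel.borel_measurable_nn_integral) (simp add: case_prod_unfold)
    moreover have "(\<integral>\<^sup>+x. indicator {p. fst p < u (snd p)} (s, x) \<partial>lborel) = emeasure lborel {x. s < u x}" for s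
    proof -
      have "(\<integral>\<^sup>+x. indicator {p. fst p < u (snd p)} (s, x) \<partial>lborel) = (\<integral>\<^sup>+x. indicator {x. s < u x} x \<partial>lborel)"
        by (intro nn_integral_cong) (auto simp: indicator_def)
      then show ?thesis by simp
    qed
    ultimately show ?thesis by simp
  qed
  note [measurable] = meas
  have key: "ennreal (1 - t) * emeasure lborel {x. s < f x} + ennreal t * emeasure lborel {x. s < g x}
     \<le> emeasure lborel {x. s < h' x}" if s: "0 \<le> s" "s < 1" for s
  proof (rule brunn_minkowski_real)
    show "bounded {x. s < f x}" "bounded {x. s < g x}"
      using supp s unfolding bounded_real by (fastforce intro: exI[of _ R])+
    show "{x. s < f x} \<noteq> {}" "{x. s < g x} \<noteq> {}" using sup s by auto
    show "(1 - t) * a + t * b \<in> {x. s < h' x}" if "a \<in> {x. s < f x}" "b \<in> {x. s < g x}" for a b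
      using le'[of a b] that by auto
  qed (use t in auto)
  have "ennreal (1 - t) * (\<integral>\<^sup>+x. f x \<partial>lborel) + ennreal t * (\<integral>\<^sup>+x. g x \<partial>lborel)
    = ennreal (1 - t) * (\<integral>\<^sup>+s\<in>{0..<1}. emeasure lborel {x. s < f x} \<partial>lborel)
      + ennreal t * (\<integral>\<^sup>+s\<in>{0..<1}. emeasure lborel {x. s < g x} \<partial>lborel)"
    by (simp add: nn_integral_layer_cake nonneg sup)
  also have "\<dots> = (\<integral>\<^sup>+s. (ennreal (1 - t) * emeasure lborel {x. s < f x} 
      + ennreal t * emeasure lborel {x. s < g x}) * indicator {0..<1} s \<partial>lborel)"
    by (simp add: nn_integral_add nn_integral_cmult distrib_right mult.assoc)
  also have "\<dots> \<le> (\<integral>\<^sup>+s\<in>{0..<1}. emeasure lborel {x. s < h' x} \<partial>lborel)"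
    using key by (intro nn_integral_mono) (auto simp: indicator_def)
  also have "\<dots> = (\<integral>\<^sup>+x. h' x \<partial>lborel)"
    using nonneg by (subst nn_integral_layer_cake) (auto simp: h'_def)
  also have "\<dots> \<le> (\<integral>\<^sup>+x. h x \<partial>lborel)"
    by (intro nn_integral_mono) (auto simp: h'_def intro: ennreal_leI)
  finally show ?thesis .
qed

text \<open>Dividing \<open>f\<close> and \<open>g\<close> by their suprema and \<open>h\<close> by
  the matching geometric mean \<open>m\<close> reduces to the normalized case. Weighted AM-GM then
  returns from the arithmetic mean of the integrals to the geometric one.\<close>

lemma prekopa_leindler_real:
  fixes f g h :: "real \<Rightarrow> real" and t c R :: real
  assumes [measurable]: "f \<in> borel_measurable borel" "g \<in> borel_measurable borel" 
    and h: "integrable lborel h"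
    and nonneg: "\<And>x. 0 \<le> f x" "\<And>x. 0 \<le> g x" "\<And>x. 0 \<le> h x"
    and bound: "\<And>x. f x \<le> c" "\<And>x. g x \<le> c"
    and supp: "\<And>x. f x \<noteq> 0 \<Longrightarrow> \<bar>x\<bar> \<le> R" "\<And>x. g x \<noteq> 0 \<Longrightarrow> \<bar>x\<bar> \<le> R"
    and t: "0 < t" "t < 1"
    and le: "\<And>x y. f x powr (1 - t) * g y powr t \<le> h ((1 - t) * x + t * y)"
  shows "(\<integral>x. f x \<partial>lborel) powr (1 - t) * (\<integral>x. g x \<partial>lborel) powr t \<le> (\<integral>x. h x \<partial>lborel)"
proof -
  have [measurable]: "h \<in> borel_measurable borel" using h by auto
  have h0: "0 \<le> (\<integral>x. h x \<partial>lborel)" using nonneg by simp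
  define a b where "a = (SUP x. f x)" and "b = (SUP x. g x)"
  have bdd: "bdd_above (range f)" "bdd_above (range g)" using bound by (meson bdd_aboveI2)+
  have ab: "f x \<le> a" "g x \<le> b" for x
    unfolding a_def b_def using bdd by (auto intro: cSUP_upper)
  have ab0: "0 \<le> a" "0 \<le> b"
    using ab(1)[of 0] ab(2)[of 0] nonneg(1)[of 0] nonneg(2)[of 0] by linarith+
  show ?thesis
  proof (cases "a = 0 \<or> b = 0")
    case True
    then have "f = (\<lambda>_. 0) \<or> g = (\<lambda>_. 0)"
    proof
      assume "a = 0"
      then have "f x = 0" for x using ab(1)[of x] nonneg(1)[of x] by linarith
      then show ?thesis by auto
    next
      assume "b = 0"
      then have "g x = 0" for x using ab(2)[of x] nonneg(2)[of x] by linarith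
      then show ?thesis by auto
    qed
    then show ?thesis using h0 by auto
  next
    case False
    with ab0 have pos: "a > 0" "b > 0" by auto
    define m where "m = a powr (1 - t) * b powr t"
    have m: "m > 0" using pos by (simp add: m_def)
    have int: "integrable lborel u"
      if [measurable]: "u \<in> borel_measurable borel"
        and u: "\<And>x. 0 \<le> u x" "\<And>x. u x \<le> c" "\<And>x. u x \<noteq> 0 \<Longrightarrow> \<bar>x\<bar> \<le> R" for u :: "real \<Rightarrow> real"
    proof (rule integrableI_bounded_set[where A="{-R..R}" and B=c])
      show "AE x in lborel. x \<notin> {- R..R} \<longrightarrow> u x = 0"
      proof (rule AE_I2)
        show "x \<notin> {- R..R} \<longrightarrow> u x = 0" for x using u(3)[of x] by (cases "u x = 0") auto
      qed
    qed (use u(1,2) in \<open>auto simp: emeasure_lborel_Icc_eq\<close>)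
    have int': "integrable lborel f" "integrable lborel g"
      by (rule int; fact)+
    have nn: "(\<integral>\<^sup>+x. u x / k \<partial>lborel) = ennreal ((\<integral>x. u x \<partial>lborel) / k)"
      if "integrable lborel u" "\<And>x. 0 \<le> u x" "k > 0" for u :: "real \<Rightarrow> real" and k
      using that by (subst nn_integral_eq_integral) auto
    have "ennreal (1 - t) * (\<integral>\<^sup>+x. f x / a \<partial>lborel) + ennreal t * (\<integral>\<^sup>+x. g x / b \<partial>lborel)
      \<le> (\<integral>\<^sup>+x. h x / m \<partial>lborel)"
    proof (rule prekopa_leindler_normalized)
      show "\<exists>x. s < f x / a" if "s < 1" for s
      proof -
        have "s * a < a" using that pos by simp
        then obtain x where "s * a < f x" 
          unfolding a_def using bdd(1) by (subst (asm) less_cSUP_iff) auto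
        then show ?thesis using pos by (auto simp: field_simps)
      qed
      show "\<exists>x. s < g x / b" if "s < 1" for s
      proof -
        have "s * b < b" using that pos by simp
        then obtain x where "s * b < g x" 
          unfolding b_def using bdd(2) by (subst (asm) less_cSUP_iff) auto
        then show ?thesis using pos by (auto simp: field_simps)
      qed
      show "min (f x / a) (g y / b) \<le> h ((1 - t) * x + t * y) / m" for x y
      proof -
        define k where "k = min (f x / a) (g y / b)"
        have k: "0 \<le> k" "k \<le> f x / a" "k \<le> g y / b"
          using nonneg pos by (auto simp: k_def)
        \<comment> \<open>The minimum is its own weighted geometric mean, hence at most that of the
          two quotients.\<close>
        have "k = k powr (1 - t) * k powr t"
          using k by (simp flip: powr_add)
        also have "\<dots> \<le> (f x / a) powr (1 - t) * (g y / b) powr t"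
          using k t by (intro mult_mono powr_mono2) auto
        also have "\<dots> = (f x powr (1 - t) * g y powr t) / m"
          using pos nonneg by (simp add: m_def powr_divide)
        also have "\<dots> \<le> h ((1 - t) * x + t * y) / m"
          using m le by (intro divide_right_mono) auto
        finally show ?thesis by (simp add: k_def)
      qed
      show "f x / a \<noteq> 0 \<Longrightarrow> \<bar>x\<bar> \<le> R" "g x / b \<noteq> 0 \<Longrightarrow> \<bar>x\<bar> \<le> R" for x
        using supp[of x] by auto
    qed (use nonneg ab pos m t in \<open>auto simp: divide_le_eq_1\<close>)
    then have "ennreal ((1 - t) * ((\<integral>x. f x \<partial>lborel) / a) + t * ((\<integral>x. g x \<partial>lborel) / b))
       \<le> ennreal ((\<integral>x. h x \<partial>lborel) / m)"
      using int' h nonneg pos m t by (simp add: nn flip: ennreal_mult ennreal_plus)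
    then have main: "(1 - t) * ((\<integral>x. f x \<partial>lborel) / a) + t * ((\<integral>x. g x \<partial>lborel) / b) \<le> (\<integral>x. h x \<partial>lborel) / m"
      using h0 m by (subst (asm) ennreal_le_iff) auto
    have FG: "0 \<le> (\<integral>x. f x \<partial>lborel)" "0 \<le> (\<integral>x. g x \<partial>lborel)" using nonneg by auto
    show ?thesis
    proof (cases "(\<integral>x. f x \<partial>lborel) = 0 \<or> (\<integral>x. g x \<partial>lborel) = 0")
      case True
      then show ?thesis using h0 by auto
    next
      case False
      with FG have FG': "0 < (\<integral>x. f x \<partial>lborel)" "0 < (\<integral>x. g x \<partial>lborel)" by auto
      have "(\<integral>x. f x \<partial>lborel) powr (1 - t) * (\<integral>x. g x \<partial>lborel) powr t / m
        = ((\<integral>x. f x \<partial>lborel) / a) powr (1 - t) * ((\<integral>x. g x \<partial>lborel) / b) powr t"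
        using pos FG' by (simp add: m_def powr_divide)
      also have "\<dots> \<le> (1 - t) * ((\<integral>x. f x \<partial>lborel) / a) + t * ((\<integral>x. g x \<partial>lborel) / b)"
        using t pos FG' by (intro Youngs_inequality_0) auto
      finally show ?thesis using main m by (simp add: divide_simps)
    qed
  qed
qed

section \<open>Prekopa-Leindler on finite products of lines\<close>

text \<open>The invariant of the induction on coordinates: fixing a coordinate keeps
  \<open>c\<close> and \<open>R\<close>. The bounds are asked of all functions, extensional or not,
  while the support condition looks only at the coordinates in \<open>I\<close>.\<close>

definition bounded_box_function :: "'i set \<Rightarrow> real \<Rightarrow> real \<Rightarrow> (('i \<Rightarrow> real) \<Rightarrow> real) \<Rightarrow> bool" where
  "bounded_box_function I c R f \<longleftrightarrow> f \<in> borel_measurable (\<Pi>\<^sub>M i\<in>I. lborel) \<and>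
     (\<forall>x. 0 \<le> f x \<and> f x \<le> c \<and> (f x \<noteq> 0 \<longrightarrow> (\<forall>i\<in>I. \<bar>x i\<bar> \<le> R)))"

interpretation lborel_PiM: product_sigma_finite "\<lambda>_. lborel :: real measure" ..

text \<open>The bound on the integral is common to all slices of a function, so it serves as the
  uniform bound that the one-dimensional inequality asks of marginals.\<close>

lemma integrable_bounded_box_function:
  fixes f :: "('i \<Rightarrow> real) \<Rightarrow> real"
  assumes f: "bounded_box_function I c R f" and fin: "finite I" and R: "0 \<le> R"
  shows "integrable (\<Pi>\<^sub>M i\<in>I. lborel) f"
    and "(\<integral>x. f x \<partial>(\<Pi>\<^sub>M i\<in>I. lborel)) \<le> c * (2 * R) ^ card I"
proof -
  let ?M = "\<Pi>\<^sub>M i\<in>I. (lborel :: real measure)"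
  define A where "A = (\<Pi>\<^sub>E i\<in>I. {-R..R})"
  have [measurable]: "f \<in> borel_measurable ?M" using f by (simp add: bounded_box_function_def)
  have A [measurable]: "A \<in> sets ?M"
    unfolding A_def using fin by (intro sets_PiM_I_finite) auto
  have "emeasure ?M A = (\<Prod>i\<in>I. ennreal (2 * R))"
    unfolding A_def using fin R by (subst lborel_PiM.emeasure_PiM) auto
  also have "\<dots> = ennreal ((2 * R) ^ card I)"
    using R by (simp add: ennreal_power)
  finally have emA: "emeasure ?M A = ennreal ((2 * R) ^ card I)" .
  have out: "f x = 0" if "x \<in> space ?M" "x \<notin> A" for x
  proof (rule ccontr)
    assume "f x \<noteq> 0"
    then have "\<forall>i\<in>I. \<bar>x i\<bar> \<le> R" using f by (auto simp: bounded_box_function_def)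
    with that show False by (simp add: A_def space_PiM PiE_iff abs_le_iff minus_le_iff)
  qed
  have le: "f x \<le> c * indicator A x" if "x \<in> space ?M" for x
    using out[OF that] f by (cases "x \<in> A") (auto simp: bounded_box_function_def)
  show int: "integrable ?M f"
  proof (rule integrableI_bounded_set[where A=A and B=c])
    show "emeasure ?M A < \<infinity>" by (simp add: emA)
    show "AE x in ?M. x \<notin> A \<longrightarrow> f x = 0" using out by (intro AE_I2) blast
    have "norm (f x) \<le> c" for x using f by (simp add: bounded_box_function_def)
    then show "AE x in ?M. x \<in> A \<longrightarrow> norm (f x) \<le> c" by (intro AE_I2) blast
  qed (rule A, measurable)
  have "(\<integral>x. f x \<partial>?M) \<le> (\<integral>x. c * indicator A x \<partial>?M)"
  proof (rule integral_mono[OF int _ le])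
    show "integrable ?M (\<lambda>x. c * indicator A x)"
      by (intro integrable_mult_right integrable_real_indicator) (simp_all add: emA)
  qed
  also have "\<dots> = c * (2 * R) ^ card I"
    using emA R by (simp add: measure_def)
  finally show "(\<integral>x. f x \<partial>?M) \<le> c * (2 * R) ^ card I" .
qed

lemma bounded_box_function_slice:
  fixes f :: "('i \<Rightarrow> real) \<Rightarrow> real"
  assumes f: "bounded_box_function (insert i I) c R f" and i: "i \<notin> I"
  shows "bounded_box_function I c R (\<lambda>x. f (x(i := s)))"
proof -
  have "(\<lambda>x. x(i := s)) \<in> measurable (\<Pi>\<^sub>M i\<in>I. lborel) (\<Pi>\<^sub>M i\<in>insert i I. lborel)"
    by (intro measurable_fun_upd[where J=I]) auto
  moreover have "f \<in> borel_measurable (\<Pi>\<^sub>M i\<in>insert i I. lborel)"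
    using f by (simp add: bounded_box_function_def)
  ultimately have "(\<lambda>x. f (x(i := s))) \<in> borel_measurable (\<Pi>\<^sub>M i\<in>I. lborel)"
    by (rule measurable_compose)
  moreover have "\<bar>x j\<bar> \<le> R" if "f (x(i := s)) \<noteq> 0" "j \<in> I" for x j
  proof -
    have "\<bar>(x(i := s)) j\<bar> \<le> R" using f that unfolding bounded_box_function_def by blast
    with that i show ?thesis by (auto split: if_splits)
  qed
  ultimately show ?thesis
    using f by (simp add: bounded_box_function_def)
qed

text \<open>Tonelli gives the identity for nonnegative integrals; finiteness of the total integral
  carries it to Bochner integrals and makes the marginal integrable.\<close>

lemma integral_slices_bounded_box_function:
  fixes f :: "('i \<Rightarrow> real) \<Rightarrow> real"
  assumes I: "finite I" "i \<notin> I" and f: "bounded_box_function (insert i I) c R f" and R: "0 \<le> R"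
  shows "(\<integral>x. f x \<partial>(\<Pi>\<^sub>M i\<in>insert i I. lborel)) = (\<integral>s. (\<integral>x. f (x(i := s)) \<partial>(\<Pi>\<^sub>M i\<in>I. lborel)) \<partial>lborel)"
    and "integrable lborel (\<lambda>s. \<integral>x. f (x(i := s)) \<partial>(\<Pi>\<^sub>M i\<in>I. lborel))"
proof -
  let ?M = "\<lambda>I. \<Pi>\<^sub>M i\<in>I. (lborel :: real measure)"
  define F where "F s = (\<integral>x. f (x(i := s)) \<partial>?M I)" for s
  interpret I: finite_product_sigma_finite "\<lambda>_. lborel :: real measure" I by standard fact
  have [measurable]: "f \<in> borel_measurable (?M (insert i I))"
    using f by (simp add: bounded_box_function_def)
  have nonneg: "0 \<le> f x" for x using f by (simp add: bounded_box_function_def)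
  have "(\<lambda>p. f ((snd p)(i := fst p))) \<in> borel_measurable (lborel \<Otimes>\<^sub>M ?M I)"
    by (rule measurable_compose[OF measurable_fun_upd[where J=I]]) auto
  then have F [measurable]: "F \<in> borel_measurable lborel"
    unfolding F_def by (intro I.borel_measurable_lebesgue_integral) (simp add: case_prod_unfold)
  have int: "integrable (?M (insert i I)) f"
    using integrable_bounded_box_function(1)[OF f] I R by simp
  have "(\<integral>\<^sup>+s. ennreal (F s) \<partial>lborel) = (\<integral>\<^sup>+s. (\<integral>\<^sup>+x. f (x(i := s)) \<partial>?M I) \<partial>lborel)"
    unfolding F_def
    using integrable_bounded_box_function(1)[OF bounded_box_function_slice[OF f I(2)] I(1) R] nonneg
    by (intro nn_integral_cong nn_integral_eq_integral[symmetric]) auto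
  also have "\<dots> = (\<integral>\<^sup>+x. f x \<partial>?M (insert i I))"
    using I by (intro lborel_PiM.product_nn_integral_insert_rev[symmetric]) auto
  also have "\<dots> = ennreal (\<integral>x. f x \<partial>?M (insert i I))"
    using int nonneg by (intro nn_integral_eq_integral) auto
  finally have eq: "(\<integral>\<^sup>+s. ennreal (F s) \<partial>lborel) = ennreal (\<integral>x. f x \<partial>?M (insert i I))" .
  have F0: "0 \<le> F s" for s unfolding F_def using nonneg by simp
  show "integrable lborel (\<lambda>s. \<integral>x. f (x(i := s)) \<partial>?M I)"
    unfolding F_def[symmetric]
    by (rule integrableI_nn_integral_finite[OF F _ eq]) (rule AE_I2[OF F0])
  have "(\<integral>s. F s \<partial>lborel) = enn2real (\<integral>\<^sup>+s. ennreal (F s) \<partial>lborel)"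
    by (rule integral_eq_nn_integral[OF F AE_I2[OF F0]])
  also have "\<dots> = (\<integral>x. f x \<partial>?M (insert i I))"
    unfolding eq by (rule enn2real_ennreal) (rule integral_nonneg_AE[OF AE_I2[OF nonneg]])
  finally show "(\<integral>x. f x \<partial>?M (insert i I)) = (\<integral>s. (\<integral>x. f (x(i := s)) \<partial>?M I) \<partial>lborel)"
    unfolding F_def ..
qed

text \<open>Fix the new coordinate of the arguments at \<open>r\<close> and \<open>s\<close>: the
  induction hypothesis for the slices is then exactly the one-dimensional premise for the marginals.
  Only extensional arguments are compared, since these are the points of the product space.\<close>

lemma prekopa_leindler_PiM:
  fixes f g h :: "('i \<Rightarrow> real) \<Rightarrow> real" and t c R :: real
  assumes "finite I" and t: "0 < t" "t < 1" and R: "0 \<le> R"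
    and "bounded_box_function I c R f" "bounded_box_function I c R g" "bounded_box_function I c R h"
    and "\<And>x y. x \<in> extensional I \<Longrightarrow> y \<in> extensional I \<Longrightarrow>
      f x powr (1 - t) * g y powr t \<le> h (\<lambda>i\<in>I. (1 - t) * x i + t * y i)"
  shows "(\<integral>x. f x \<partial>(\<Pi>\<^sub>M i\<in>I. lborel)) powr (1 - t) * (\<integral>x. g x \<partial>(\<Pi>\<^sub>M i\<in>I. lborel)) powr t 
    \<le> (\<integral>x. h x \<partial>(\<Pi>\<^sub>M i\<in>I. lborel))"
  using assms(1,5-)
proof (induction I arbitrary: f g h rule: finite_induct)
  case empty
  \<comment> \<open>The product over no coordinates is a point mass at \<open>u\<close>, so the
    claim is the premise at this point.\<close>
  define u :: "'i \<Rightarrow> real" where "u = (\<lambda>_. undefined)"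
  have "f u powr (1 - t) * g u powr t \<le> h (\<lambda>i\<in>{}. (1 - t) * u i + t * u i)"
    by (rule empty.prems(4)) (simp_all add: u_def)
  also have "(\<lambda>i\<in>{}. (1 - t) * u i + t * u i) = u"
    by (rule ext) (simp add: u_def)
  finally show ?case by (simp add: u_def PiM_empty lebesgue_integral_count_space_finite)
next
  case (insert i I)
  let ?M = "\<Pi>\<^sub>M i\<in>I. (lborel :: real measure)"
  define S where "S u s = (\<integral>x. u (x(i := s)) \<partial>?M)" for u :: "('i \<Rightarrow> real) \<Rightarrow> real" and s :: real
  have slice: "bounded_box_function I c R (\<lambda>x. u (x(i := s)))"
    if "bounded_box_function (insert i I) c R u" for u s
    using bounded_box_function_slice[OF that] insert.hyps by blast
  have int: "(\<integral>x. u x \<partial>(\<Pi>\<^sub>M i\<in>insert i I. lborel)) = (\<integral>s. S u s \<partial>lborel)" "integrable lborel (S u)"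
    if "bounded_box_function (insert i I) c R u" for u
    unfolding S_def using insert.hyps that R
    by (intro integral_slices_bounded_box_function[OF _ _ that]; simp)+
  have nonneg: "0 \<le> S u s" if "bounded_box_function (insert i I) c R u" for u s
    unfolding S_def using that by (simp add: bounded_box_function_def)
  have bound: "S u s \<le> c * (2 * R) ^ card I" if "bounded_box_function (insert i I) c R u" for u s
    unfolding S_def using integrable_bounded_box_function(2)[OF slice[OF that]] insert.hyps R by simp
  have supp: "\<bar>s\<bar> \<le> R" if u: "bounded_box_function (insert i I) c R u" and "S u s \<noteq> 0" for u s
  proof (rule ccontr)
    assume "\<not> \<bar>s\<bar> \<le> R"
    then have "u (x(i := s)) = 0" for x
      using u unfolding bounded_box_function_def by (metis fun_upd_same insertI1)
    then have "S u s = 0" by (simp add: S_def)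
    with \<open>S u s \<noteq> 0\<close> show False by blast
  qed
  have "(\<integral>s. S f s \<partial>lborel) powr (1 - t) * (\<integral>s. S g s \<partial>lborel) powr t \<le> (\<integral>s. S h s \<partial>lborel)"
  proof (rule prekopa_leindler_real)
    show "S f r powr (1 - t) * S g s powr t \<le> S h ((1 - t) * r + t * s)" for r s
      unfolding S_def
    proof (rule insert.IH)
      fix x y :: "'i \<Rightarrow> real" assume xy: "x \<in> extensional I" "y \<in> extensional I"
      have "f (x(i := r)) powr (1 - t) * g (y(i := s)) powr t 
        \<le> h (\<lambda>j\<in>insert i I. (1 - t) * (x(i := r)) j + t * (y(i := s)) j)"
        using xy by (intro insert.prems) (auto simp: extensional_def)
      also have "(\<lambda>j\<in>insert i I. (1 - t) * (x(i := r)) j + t * (y(i := s)) j)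
         = (\<lambda>i\<in>I. (1 - t) * x i + t * y i)(i := (1 - t) * r + t * s)"
        using insert.hyps by auto
      finally show "f (x(i := r)) powr (1 - t) * g (y(i := s)) powr t
        \<le> h ((\<lambda>i\<in>I. (1 - t) * x i + t * y i)(i := (1 - t) * r + t * s))" .
    qed (rule slice[OF insert.prems(1)] slice[OF insert.prems(2)] slice[OF insert.prems(3)])+
    show "S f \<in> borel_measurable borel" "S g \<in> borel_measurable borel"
      using int(2)[OF insert.prems(1)] int(2)[OF insert.prems(2)] by auto
  qed (rule t int(2)[OF insert.prems(3)]
      nonneg[OF insert.prems(1)] nonneg[OF insert.prems(2)] nonneg[OF insert.prems(3)]
      bound[OF insert.prems(1)] bound[OF insert.prems(2)]
      supp[OF insert.prems(1)] supp[OF insert.prems(2)], assumption?)+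
  then show ?case by (simp only: int(1)[OF insert.prems(1)] int(1)[OF insert.prems(2)] int(1)[OF insert.prems(3)])
qed

text \<open>Prekopa-Leindler for indicators: as \<open>0 powr\<close> anything is 0, its premise
  says something only when both points lie in their sets. This form without n-th roots is the one
  that yields log-concavity of section volumes.\<close>

lemma brunn_minkowski_euclidean:
  fixes X Y Z :: "'a::euclidean_space set" and t :: real
  assumes t: "0 < t" "t < 1"
    and meas: "X \<in> sets borel" "Y \<in> sets borel" "Z \<in> sets borel"
    and bdd: "bounded X" "bounded Y" "bounded Z"
    and sub: "\<And>x y. x \<in> X \<Longrightarrow> y \<in> Y \<Longrightarrow> (1 - t) *\<^sub>R x + t *\<^sub>R y \<in> Z"
  shows "measure lborel X powr (1 - t) * measure lborel Y powr t \<le> measure lborel Z"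
proof -
  let ?M = "\<Pi>\<^sub>M b\<in>(Basis :: 'a set). (lborel :: real measure)"
  define T where "T f = (\<Sum>b\<in>Basis. f b *\<^sub>R b)" for f :: "'a \<Rightarrow> real"
  have T [measurable]: "T \<in> measurable ?M borel" unfolding T_def by measurable
  have lb: "lborel = distr ?M borel T" unfolding T_def by (rule lborel_eq)
  have TB: "T f \<bullet> b = f b" if "b \<in> Basis" for f b
    using that by (simp add: T_def inner_sum_left inner_Basis if_distrib cong: if_cong)
  have int: "(\<integral>f. indicator S (T f) \<partial>?M) = measure lborel S" if S: "S \<in> sets borel" for S
  proof -
    have "measure lborel S = (\<integral>x. indicator S x \<partial>distr ?M borel T)"
      unfolding lb[symmetric] using S by simp
    also have "\<dots> = (\<integral>f. indicator S (T f) \<partial>?M)"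
      using S by (subst integral_distr) auto
    finally show ?thesis ..
  qed
  have "bounded (X \<union> Y \<union> Z)" using bdd by simp
  then obtain R where R: "R > 0" "\<forall>x \<in> X \<union> Y \<union> Z. norm x \<le> R"
    unfolding bounded_pos by blast
  have box: "bounded_box_function Basis 1 R (\<lambda>f. indicator S (T f))"
    if S: "S \<in> sets borel" "S \<subseteq> X \<union> Y \<union> Z" for S
  proof -
    have "\<bar>f b\<bar> \<le> R" if "T f \<in> S" "b \<in> Basis" for f b
      using that S R Basis_le_norm[of b "T f"] by (force simp: TB)
    moreover have "(\<lambda>f. indicator S (T f) :: real) \<in> borel_measurable ?M"
      using S by measurable
    ultimately show ?thesis
      unfolding bounded_box_function_def by (auto simp: indicator_def)
  qed
  have "(\<integral>f. indicator X (T f) \<partial>?M) powr (1 - t) * (\<integral>f. indicator Y (T f) \<partial>?M) powr t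
    \<le> (\<integral>f. indicator Z (T f) \<partial>?M)"
  proof (rule prekopa_leindler_PiM[where c=1 and R=R])
    fix x y :: "'a \<Rightarrow> real"
    have "T (\<lambda>i\<in>Basis. (1 - t) * x i + t * y i) = (1 - t) *\<^sub>R T x + t *\<^sub>R T y"
      by (rule euclidean_eqI) (simp add: TB inner_add_left)
    then show "indicator X (T x) powr (1 - t) * indicator Y (T y) powr t
      \<le> (indicator Z (T (\<lambda>i\<in>Basis. (1 - t) * x i + t * y i)) :: real)"
      using sub[of "T x" "T y"] by (auto simp: indicator_def)
  qed (use t R box meas in auto)
  then show ?thesis by (simp add: int meas)
qed

lemma lborel_integral_scaleR:
  fixes f :: "'a::euclidean_space \<Rightarrow> real"
  assumes [measurable]: "f \<in> borel_measurable borel" and c: "c > 0"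
  shows "(\<integral>x. f x \<partial>lborel) = c ^ DIM('a) * (\<integral>x. f (c *\<^sub>R x) \<partial>lborel)"
proof -
  have "(\<integral>x. f x \<partial>lborel) = (\<integral>x. f x \<partial>density (distr lborel borel (\<lambda>x. 0 + c *\<^sub>R x)) (\<lambda>_. ennreal (\<bar>c\<bar>^DIM('a))))"
    using lborel_affine[of c "0::'a"] c by simp
  also have "\<dots> = c ^ DIM('a) * (\<integral>x. f (c *\<^sub>R x) \<partial>lborel)"
    using c by (subst integral_density) (auto simp: integral_distr)
  finally show ?thesis .
qed

lemma lborel_integral_translate:
  fixes f :: "'a::euclidean_space \<Rightarrow> real"
  assumes [measurable]: "f \<in> borel_measurable borel"
  shows "(\<integral>x. f x \<partial>lborel) = (\<integral>x. f (a + x) \<partial>lborel)"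
proof -
  have "(\<integral>x. f x \<partial>lborel) = (\<integral>x. f x \<partial>distr lborel borel ((+) a))"
    by (simp add: lborel_distr_plus)
  also have "\<dots> = (\<integral>x. f (a + x) \<partial>lborel)"
    by (subst integral_distr) auto
  finally show ?thesis .
qed

section \<open>Positive sublinear functions\<close>

text \<open>The gauges of convex bodies with 0 in the interior. The lower norm bound makes sublevel
  sets bounded, the upper one makes 0 an interior point. Symmetry is not asked:
  \<open>p (- x)\<close> and \<open>p x\<close> may differ.\<close>

definition positive_sublinear :: "('a::real_normed_vector \<Rightarrow> real) \<Rightarrow> bool" where
  "positive_sublinear p \<longleftrightarrow> (\<forall>x y. p (x + y) \<le> p x + p y) \<and> (\<forall>c x. 0 \<le> c \<longrightarrow> p (c *\<^sub>R x) = c * p x) \<and>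
     (\<exists>r>0. \<forall>x. r * norm x \<le> p x) \<and> (\<exists>C. \<forall>x. p x \<le> C * norm x)"

locale positive_sublinear_function =
  fixes p :: "'a::euclidean_space \<Rightarrow> real"
  assumes ps: "positive_sublinear p"
begin

lemma subadd: "p (x + y) \<le> p x + p y" 
  using ps by (simp add: positive_sublinear_def)

lemma homogeneous: "0 \<le> c \<Longrightarrow> p (c *\<^sub>R x) = c * p x"
  using ps by (simp add: positive_sublinear_def)

lemma lower_bound: obtains r where "r > 0" "\<And>x. r * norm x \<le> p x"
  using ps unfolding positive_sublinear_def by blast

lemma upper_bound: obtains C where "C > 0" "\<And>x. p x \<le> C * norm x"
proof -
  obtain C where C: "p x \<le> C * norm x" for x
    using ps unfolding positive_sublinear_def by blast
  have "p x \<le> max C 1 * norm x" for x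
    using C[of x] mult_right_mono[of C "max C 1" "norm x"] by simp
  then show ?thesis using that[of "max C 1"] by simp
qed

lemma nonneg [simp]: "0 \<le> p x"
proof -
  obtain r where "r > 0" "\<And>x. r * norm x \<le> p x" by (rule lower_bound) blast
  then show ?thesis by (meson mult_nonneg_nonneg less_imp_le norm_ge_zero order_trans)
qed

lemma zero [simp]: "p 0 = 0"
  using homogeneous[of 0 0] by simp

lemma eq_0_iff: "p x \<le> 0 \<longleftrightarrow> x = 0"
proof
  assume "p x \<le> 0"
  obtain r where r: "r > 0" "\<And>x. r * norm x \<le> p x" by (rule lower_bound) blast
  then have "r * norm x \<le> 0" using \<open>p x \<le> 0\<close> order_trans by blast
  with r show "x = 0" by (simp add: mult_le_0_iff)
qed simp

lemma convex_comb: "0 \<le> t \<Longrightarrow> t \<le> 1 \<Longrightarrow> p ((1 - t) *\<^sub>R x + t *\<^sub>R y) \<le> (1 - t) * p x + t * p y"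
  using subadd[of "(1 - t) *\<^sub>R x" "t *\<^sub>R y"] by (simp add: homogeneous)

text \<open>Without symmetry, the increment is bounded on its two sides by \<open>p (x - y)\<close>
  and \<open>p (y - x)\<close>, both controlled by the norm.\<close>

lemma continuous: "continuous_on S p"
proof -
  obtain C where C: "C > 0" "\<And>x. p x \<le> C * norm x" by (rule upper_bound) blast
  have "\<bar>p x - p y\<bar> \<le> C * dist x y" for x y
    using subadd[of y "x - y"] subadd[of x "y - x"] C(2)[of "x - y"] C(2)[of "y - x"]
    by (simp add: dist_norm norm_minus_commute abs_le_iff)
  then have "C-lipschitz_on S p"
    using C by (intro lipschitz_onI) (auto simp: dist_real_def)
  then show ?thesis by (rule lipschitz_on_continuous_on)
qed

lemma continuous_compose [continuous_intros]: "continuous_on S f \<Longrightarrow> continuous_on S (\<lambda>x. p (f x))"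
  by (rule continuous_on_compose2[OF continuous[of UNIV]]) auto

lemma compact_sublevel: "compact {x. p x \<le> s}"
proof -
  obtain r where r: "r > 0" "\<And>x. r * norm x \<le> p x" by (rule lower_bound) blast
  have "norm x \<le> s / r" if "p x \<le> s" for x
    using r(2)[of x] r(1) that by (simp add: field_simps)
  then have "bounded {x. p x \<le> s}" by (auto intro: boundedI)
  moreover have "closed {x. p x \<le> s}"
    by (intro closed_Collect_le continuous_intros)
  ultimately show ?thesis by (simp add: compact_eq_bounded_closed)
qed

lemma measurable_p [measurable]: "p \<in> borel_measurable borel"
  by (intro borel_measurable_continuous_onI continuous)

text \<open>Dilation by \<open>s\<close> contributes \<open>s ^ DIM('a)\<close> from Lebesgue
  measure and \<open>s ^ d\<close> from \<open>g\<close>. Volumes use \<open>d = 0\<close>, first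
  moments \<open>d = 1\<close>.\<close>

lemma integral_sublevel:
  fixes g :: "'a \<Rightarrow> real"
  assumes [measurable]: "g \<in> borel_measurable borel" and g: "\<And>c x. 0 < c \<Longrightarrow> g (c *\<^sub>R x) = c ^ d * g x" 
    and s: "0 \<le> s"
  shows "(\<integral>x. indicator {x. p x \<le> s} x * g x \<partial>lborel) = s ^ (DIM('a) + d) * (\<integral>x. indicator {x. p x \<le> 1} x * g x \<partial>lborel)"
proof (cases "s = 0")
  \<comment> \<open>The dilation degenerates, but the sublevel set is the null set of 0 alone and
    the power on the right has a positive exponent.\<close>
  case True
  have "(\<integral>x. indicator {x. p x \<le> s} x * g x \<partial>lborel) = (\<integral>x. 0 \<partial>(lborel :: 'a measure))"
    using True AE_lborel_singleton[of "0::'a"] by (intro integral_cong_AE) (auto simp: eq_0_iff)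
  then show ?thesis using True by simp
next
  case False
  with s have s: "s > 0" by simp
  have "(\<integral>x. indicator {x. p x \<le> s} x * g x \<partial>lborel)
     = s ^ DIM('a) * (\<integral>x. indicator {x. p x \<le> s} (s *\<^sub>R x) * g (s *\<^sub>R x) \<partial>lborel)"
    using s by (intro lborel_integral_scaleR) auto
  also have "(\<integral>x. indicator {x. p x \<le> s} (s *\<^sub>R x) * g (s *\<^sub>R x) \<partial>lborel)
     = (\<integral>x. s ^ d * (indicator {x. p x \<le> 1} x * g x) \<partial>lborel)"
    using s by (intro Bochner_Integration.integral_cong) (auto simp: indicator_def g homogeneous)
  finally show ?thesis by (simp add: power_add)
qed

end

section \<open>Beta integrals and powers of \<open>1 - p\<close>\<close>

lemma integral_beta_power:
  fixes j m :: nat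
  shows "(\<integral>s. indicator {0..1} s * ((1 - s) ^ j * s ^ m) \<partial>lborel) = (fact j * fact m / fact (j + m + 1) :: real)"
proof -
  have "((\<lambda>t. t powr (real (m + 1) - 1) * (1 - t) powr (real (j + 1) - 1)) has_integral Beta (real (m + 1)) (real (j + 1))) {0..1}"
    by (rule has_integral_Beta_real) auto
  \<comment> \<open>Since \<open>0 powr 0 = 0\<close> but \<open>0 ^ 0 = 1\<close>, the integrands
    may differ at the two endpoints.\<close>
  then have "((\<lambda>s. (1 - s) ^ j * s ^ m) has_integral Beta (real (m + 1)) (real (j + 1))) {0..1}"
    by (rule has_integral_spike_finite[where S="{0, 1}", rotated -1]) (auto simp: powr_realpow)
  then have "integral {0..1} (\<lambda>s. (1 - s) ^ j * s ^ m) = Beta (real (m + 1)) (real (j + 1))"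
    by (rule integral_unique)
  also have "\<dots> = fact j * fact m / fact (j + m + 1)"
    using Gamma_fact[of m, where ?'a = real] Gamma_fact[of j, where ?'a = real] 
      Gamma_fact[of "j + m + 1", where ?'a = real]
    by (simp add: Beta_def add_ac)
  finally have "integral {0..1} (\<lambda>s. (1 - s) ^ j * s ^ m) = (fact j * fact m / fact (j + m + 1) :: real)" .
  moreover have "set_integrable lborel {0..1} (\<lambda>s::real. (1 - s) ^ j * s ^ m)"
    by (intro borel_integrable_atLeastAtMost' continuous_intros)
  ultimately show ?thesis
    using set_borel_integral_eq_integral(2)[of "{0..1}" "\<lambda>s::real. (1 - s) ^ j * s ^ m"]
    by (simp add: set_lebesgue_integral_def)
qed

text \<open>Used with \<open>a = p x\<close>: the power becomes an integral over the levels above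
  \<open>p x\<close>, which brings sublevel sets into play.\<close>

lemma power_eq_integral:
  fixes a :: real
  assumes "a \<le> 1"
  shows "(1 - a) ^ Suc j = (\<integral>s. indicator {a..1} s * (real (Suc j) * (1 - s) ^ j) \<partial>lborel)"
proof -
  have "(\<integral>s. (real (Suc j) * (1 - s) ^ j) * indicator {a..1} s \<partial>lborel) = - ((1 - 1) ^ Suc j) - (- ((1 - a) ^ Suc j))"
  proof (rule integral_FTC_Icc_real[OF assms])
    show "DERIV (\<lambda>s. - ((1 - s) ^ Suc j)) x :> real (Suc j) * (1 - x) ^ j" for x :: real
      by (auto intro!: derivative_eq_intros simp del: power_Suc)
  qed simp
  then show ?thesis by (simp add: mult.commute)
qed

context positive_sublinear_function
begin

text \<open>Expand the power over the levels \<open>s\<close> from \<open>p x\<close> to 1 and swap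
  the integrals. The inner one scales like \<open>s ^ (DIM('a) + d)\<close>, and \<open>k\<close>
  times Beta(n + d + 1, k), with n the dimension, is the constant.\<close>

lemma integral_power_sublevel:
  fixes g :: "'a \<Rightarrow> real"
  assumes cont: "continuous_on UNIV g" and g: "\<And>c x. 0 < c \<Longrightarrow> g (c *\<^sub>R x) = c ^ d * g x"
    and k: "0 < k"
  shows "(\<integral>x. indicator {x. p x \<le> 1} x * (g x * (1 - p x) ^ k) \<partial>lborel)
    = fact k * fact (DIM('a) + d) / fact (k + DIM('a) + d) * (\<integral>x. indicator {x. p x \<le> 1} x * g x \<partial>lborel)"
proof -
  obtain j where j: "k = Suc j" using k by (cases k) auto
  let ?m = "DIM('a) + d"
  define G where "G = (\<integral>x. indicator {x. p x \<le> 1} x * g x \<partial>lborel)"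
  have gm [measurable]: "g \<in> borel_measurable borel"
    using cont by (rule borel_measurable_continuous_onI)
  \<comment> \<open>Compactness of this region supplies the integrability that the swap
    requires.\<close>
  define S where "S = {z. p (fst z) \<le> snd z \<and> snd z \<le> 1}"
  define J where "J z = indicator S z * (g (fst z) * (real k * (1 - snd z) ^ j))" for z
  have "closed S"
    unfolding S_def
    by (intro closed_Collect_conj closed_Collect_le continuous_intros)
  moreover have "S \<subseteq> {x. p x \<le> 1} \<times> {0..1}"
    unfolding S_def by (auto intro: order_trans[OF nonneg])
  ultimately have "compact S"
    using compact_Times[OF compact_sublevel compact_Icc]
    by (metis compact_Int_closed inf.absorb_iff2)
  then have "integrable lborel (\<lambda>z. indicator S z *\<^sub>R (g (fst z) * (real k * (1 - snd z) ^ j)))"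
    by (rule borel_integrable_compact)
       (intro continuous_intros continuous_on_compose2[OF cont]; simp)
  then have J: "integrable (lborel \<Otimes>\<^sub>M lborel) (case_prod (\<lambda>x s. J (x, s)))"
    by (simp add: J_def lborel_prod case_prod_unfold)
  have "(\<integral>x. indicator {x. p x \<le> 1} x * (g x * (1 - p x) ^ k) \<partial>lborel) = (\<integral>x. (\<integral>s. J (x, s) \<partial>lborel) \<partial>lborel)"
  proof (rule Bochner_Integration.integral_cong)
    fix x :: 'a
    have "(\<integral>s. J (x, s) \<partial>lborel) = (\<integral>s. g x * (indicator {p x..1} s * (real (Suc j) * (1 - s) ^ j)) \<partial>lborel)"
      by (rule Bochner_Integration.integral_cong) (auto simp: J_def S_def j indicator_def)
    also have "\<dots> = g x * (\<integral>s. indicator {p x..1} s * (real (Suc j) * (1 - s) ^ j) \<partial>lborel)"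
      by (rule integral_mult_right_zero)
    also have "\<dots> = indicator {x. p x \<le> 1} x * (g x * (1 - p x) ^ k)"
    proof (cases "p x \<le> 1")
      case True
      then show ?thesis by (simp only: power_eq_integral[symmetric] j) simp
    qed simp
    finally show "indicator {x. p x \<le> 1} x * (g x * (1 - p x) ^ k) = (\<integral>s. J (x, s) \<partial>lborel)" ..
  qed simp
  also have "\<dots> = (\<integral>s. (\<integral>x. J (x, s) \<partial>lborel) \<partial>lborel)"
    by (rule lborel_pair.Fubini_integral[OF J, symmetric])
  also have "\<dots> = (\<integral>s. (real k * G) * (indicator {0..1} s * ((1 - s) ^ j * s ^ ?m)) \<partial>lborel)"
  proof (rule Bochner_Integration.integral_cong)
    fix s :: real
    show "(\<integral>x. J (x, s) \<partial>lborel) = (real k * G) * (indicator {0..1} s * ((1 - s) ^ j * s ^ ?m))"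
    proof (cases "0 \<le> s \<and> s \<le> 1")
      case True
      then have "(\<integral>x. J (x, s) \<partial>lborel) = (\<integral>x. (real k * (1 - s) ^ j) * (indicator {x. p x \<le> s} x * g x) \<partial>lborel)"
        by (intro Bochner_Integration.integral_cong) (auto simp: J_def S_def indicator_def)
      also have "\<dots> = (real k * (1 - s) ^ j) * (\<integral>x. indicator {x. p x \<le> s} x * g x \<partial>lborel)"
        by (rule integral_mult_right_zero)
      also have "(\<integral>x. indicator {x. p x \<le> s} x * g x \<partial>lborel) = s ^ ?m * G"
        unfolding G_def using True by (intro integral_sublevel gm g) auto
      finally show ?thesis using True by simp
    next
      case False
      then have "J (x, s) = 0" for x
        using order_trans[OF nonneg[of x], of s] by (auto simp: J_def S_def indicator_def)
      then show ?thesis using False by simp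
    qed
  qed simp
  also have "\<dots> = (real k * G) * (\<integral>s. indicator {0..1} s * ((1 - s) ^ j * s ^ ?m) \<partial>lborel)"
    by (rule integral_mult_right_zero)
  also have "\<dots> = fact k * fact ?m / fact (k + DIM('a) + d) * G"
    unfolding integral_beta_power by (simp add: j add_ac)
  finally show ?thesis unfolding G_def .
qed

lemma integrable_sublevel:
  fixes g :: "'a \<Rightarrow> real"
  assumes "continuous_on UNIV g"
  shows "integrable lborel (\<lambda>x. indicator {x. p x \<le> s} x * g x)"
  using borel_integrable_compact[OF compact_sublevel continuous_on_subset[OF assms], of s] by simp

end

section \<open>Fibers of the sum map\<close>

locale positive_sublinear_pair = p: positive_sublinear_function p + q: positive_sublinear_function q
  for p q :: "'a::euclidean_space \<Rightarrow> real"
begin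

text \<open>The points (x, y) of W with x + y = z, recorded by x alone, so that their volume is an
  n-dimensional one.\<close>

definition fiber :: "'a \<Rightarrow> 'a set" where
  "fiber z = {x. p x + q (z - x) \<le> 1}"

definition fiber_volume :: "'a \<Rightarrow> real" where
  "fiber_volume z = measure lborel (fiber z)"

lemma fiber_volume_nonneg: "0 \<le> fiber_volume z"
  by (simp add: fiber_volume_def)

lemma fiber_subset: "fiber z \<subseteq> {x. p x \<le> 1}"
  using q.nonneg by (auto simp: fiber_def intro: order_trans[rotated])

lemma compact_fiber: "compact (fiber z)"
proof -
  have "closed (fiber z)"
    unfolding fiber_def by (intro closed_Collect_le continuous_intros p.continuous_compose q.continuous_compose)
  then show ?thesis
    using p.compact_sublevel[of 1] fiber_subset[of z] by (metis compact_Int_closed inf.absorb_iff2)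
qed

text \<open>\<open>p x + q (z - x)\<close> is jointly convex in x and z, so convex combinations of
  points of two fibers lie in the fiber over the combined base point.\<close>

lemma fiber_volume_log_concave:
  assumes t: "0 < t" "t < 1"
  shows "fiber_volume x powr (1 - t) * fiber_volume y powr t \<le> fiber_volume ((1 - t) *\<^sub>R x + t *\<^sub>R y)"
  unfolding fiber_volume_def
proof (rule brunn_minkowski_euclidean[OF t])
  fix u w assume u: "u \<in> fiber x" and w: "w \<in> fiber y"
  let ?z = "(1 - t) *\<^sub>R x + t *\<^sub>R y" and ?v = "(1 - t) *\<^sub>R u + t *\<^sub>R w"
  have "?z - ?v = (1 - t) *\<^sub>R (x - u) + t *\<^sub>R (y - w)" by (simp add: algebra_simps)
  then have "p ?v + q (?z - ?v) \<le> ((1 - t) * p u + t * p w) + ((1 - t) * q (x - u) + t * q (y - w))"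
    using p.convex_comb[of t u w] q.convex_comb[of t "x - u" "y - w"] t by simp
  also have "\<dots> = (1 - t) * (p u + q (x - u)) + t * (p w + q (y - w))" by (simp add: algebra_simps)
  also have "\<dots> \<le> (1 - t) * 1 + t * 1"
    using u w t by (intro add_mono mult_left_mono) (auto simp: fiber_def)
  finally show "?v \<in> fiber ?z" by (simp add: fiber_def)
qed (use compact_fiber in \<open>auto intro: borel_compact compact_imp_bounded\<close>)

text \<open>Positivity in every direction around 0 is what excludes a vertical supporting
  hyperplane.\<close>

lemma fiber_volume_pos_near_0:
  obtains d where "d > 0" "\<And>z. norm z < d \<Longrightarrow> 0 < fiber_volume z"
proof -
  obtain C where C: "C > 0" "\<And>x. p x \<le> C * norm x" by (rule p.upper_bound) blast
  obtain C' where C': "C' > 0" "\<And>x. q x \<le> C' * norm x" by (rule q.upper_bound) blast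
  \<comment> \<open>If x and z have norm at most \<open>d\<close>, then z - x has norm at most
    \<open>2 * d\<close>; hence the factor 2 at \<open>C'\<close>.\<close>
  define d where "d = 1 / (C + 2 * C')"
  have d: "d > 0" using C C' by (simp add: d_def)
  have "0 < fiber_volume z" if z: "norm z < d" for z
  proof -
    have "ball 0 d \<subseteq> fiber z"
    proof
      fix x assume "x \<in> ball (0::'a) d"
      then have x: "norm x \<le> d" by simp
      have "p x + q (z - x) \<le> C * norm x + C' * norm (z - x)" using C(2) C'(2) by (rule add_mono)
      also have "\<dots> \<le> C * d + C' * (d + d)"
        using x z C C' norm_triangle_ineq4[of z x] by (intro add_mono mult_left_mono) auto
      also have "\<dots> = (C + 2 * C') * d" by (simp add: algebra_simps)
      also have "\<dots> = 1" using C C' by (simp add: d_def)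
      finally show "x \<in> fiber z" by (simp add: fiber_def)
    qed
    then have "measure lebesgue (ball (0::'a) d) \<le> measure lebesgue (fiber z)"
      by (intro measure_mono_fmeasurable lmeasurable_compact compact_fiber) auto
    moreover have "0 < measure lebesgue (ball (0::'a) d)" using content_ball_pos[OF d] by simp
    ultimately have "0 < measure lebesgue (fiber z)" by linarith
    then show ?thesis
      using compact_fiber[of z] by (simp add: fiber_volume_def borel_compact)
  qed
  with d that show ?thesis by blast
qed

text \<open>The hyperplane supports the hypograph of \<open>ln fiber_volume\<close> above the origin; since
  \<open>exp s * (1 - s) \<le> 1\<close>, it yields a bound that is linear in the section volumes.\<close>

lemma fiber_volume_tangent:
  obtains v where "\<And>z. fiber_volume z * (1 - v \<bullet> z) \<le> fiber_volume 0"
proof -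
  let ?h = fiber_volume
  \<comment> \<open>Restricted to positive volumes, where \<open>ln\<close> is meaningful.\<close>
  define S where "S = {w :: 'a \<times> real. 0 < ?h (fst w) \<and> snd w \<le> ln (?h (fst w))}"
  \<comment> \<open>The ray omits its endpoint, which belongs to \<open>S\<close>; the inequality at
    the endpoint is recovered by a limit from the right.\<close>
  define U where "U = {w :: 'a \<times> real. fst w = 0 \<and> ln (?h 0) < snd w}"
  obtain d where d: "d > 0" "\<And>z. norm z < d \<Longrightarrow> 0 < ?h z" by (rule fiber_volume_pos_near_0) blast
  have h0: "0 < ?h 0" using d by simp
  have "convex S"
    unfolding convex_alt
  proof (intro ballI allI impI)
    fix a b :: "'a \<times> real" and t :: real
    assume a: "a \<in> S" and b: "b \<in> S" and t: "0 \<le> t \<and> t \<le> 1"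
    show "(1 - t) *\<^sub>R a + t *\<^sub>R b \<in> S"
    proof (cases "t = 0 \<or> t = 1")
      case True
      then show ?thesis using a b by auto
    next
      case False
      with t have t: "0 < t" "t < 1" by auto
      let ?z = "(1 - t) *\<^sub>R fst a + t *\<^sub>R fst b"
      have pos: "0 < ?h (fst a)" "0 < ?h (fst b)" using a b by (auto simp: S_def)
      then have "0 < ?h (fst a) powr (1 - t) * ?h (fst b) powr t" by simp
      also have le: "\<dots> \<le> ?h ?z" by (rule fiber_volume_log_concave[OF t])
      finally have z: "0 < ?h ?z" .
      have "(1 - t) * snd a + t * snd b \<le> (1 - t) * ln (?h (fst a)) + t * ln (?h (fst b))"
        using a b t by (intro add_mono mult_left_mono) (auto simp: S_def)
      also have "\<dots> = ln (?h (fst a) powr (1 - t) * ?h (fst b) powr t)"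
        using pos by (simp add: ln_mult)
      also have "\<dots> \<le> ln (?h ?z)" using pos le z by (subst ln_le_cancel_iff) auto
      finally show ?thesis using z by (simp add: S_def)
    qed
  qed
  moreover have "convex U"
  proof -
    have "U = {0} \<times> {ln (?h 0)<..}" by (auto simp: U_def)
    then show ?thesis by (simp add: convex_Times)
  qed
  moreover have "S \<noteq> {}" using h0 by (auto simp: S_def intro!: exI[of _ "(0, ln (?h 0))"])
  moreover have "U \<noteq> {}" by (auto simp: U_def gt_ex)
  moreover have "S \<inter> U = {}" by (auto simp: S_def U_def)
  ultimately obtain a b where ab: "a \<noteq> 0" "\<forall>w\<in>S. a \<bullet> w \<le> b" "\<forall>w\<in>U. b \<le> a \<bullet> w"
    using separating_hyperplane_sets[of S U] by auto
  obtain w c where a: "a = (w, c)" by (cases a)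
  have upper: "b \<le> c * r" if "ln (?h 0) < r" for r
    using bspec[OF ab(3), of "(0, r)"] that by (simp add: U_def a inner_prod_def)
  have lower: "w \<bullet> z + c * r \<le> b" if "0 < ?h z" "r \<le> ln (?h z)" for z r
    using bspec[OF ab(2), of "(z, r)"] that by (simp add: S_def a inner_prod_def)
  have "b \<le> c * ln (?h 0)"
  proof (rule tendsto_lowerbound)
    show "((\<lambda>r. c * r) \<longlongrightarrow> c * ln (?h 0)) (at_right (ln (?h 0)))" by (intro tendsto_intros)
    show "\<forall>\<^sub>F r in at_right (ln (?h 0)). b \<le> c * r"
      using upper by (auto simp: eventually_at_right_less intro!: eventually_mono[OF eventually_at_right_less])
  qed simp
  with lower have main: "w \<bullet> z + c * ln (?h z) \<le> c * ln (?h 0)" if "0 < ?h z" for z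
    using that by (meson order_refl order_trans)
  \<comment> \<open>Over 0, \<open>S\<close> extends downwards and \<open>U\<close> upwards, so the
    normal cannot point down.\<close>
  have "0 \<le> c"
  proof (rule ccontr)
    assume c: "\<not> 0 \<le> c"
    have "c * (ln (?h 0) - 1) \<le> b" using lower[of 0 "ln (?h 0) - 1"] h0 by simp
    moreover have "b \<le> c * (ln (?h 0) + 1)" using upper by simp
    ultimately show False using c by (simp add: algebra_simps)
  qed
  \<comment> \<open>A vertical hyperplane would force \<open>w \<bullet> z \<le> 0\<close> for all z
    near 0, which fails in the direction of \<open>w\<close> itself.\<close>
  moreover have "c \<noteq> 0"
  proof
    assume c: "c = 0"
    then have "w \<noteq> 0" using ab(1) a by (simp add: zero_prod_def)
    let ?z = "(d / (2 * norm w)) *\<^sub>R w"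
    have "norm ?z < d" using d \<open>w \<noteq> 0\<close> by simp
    then have "w \<bullet> ?z \<le> 0" using main[of ?z] d(2) c by simp
    moreover have "0 < w \<bullet> ?z" using d \<open>w \<noteq> 0\<close> by simp
    ultimately show False by simp
  qed
  ultimately have c: "0 < c" by simp
  \<comment> \<open>The slope of the hyperplane as a graph over the base space: the log-volume at z
    exceeds that at 0 by at most \<open>v \<bullet> z\<close>.\<close>
  define v where "v = - (1 / c) *\<^sub>R w"
  have "?h z * (1 - v \<bullet> z) \<le> ?h 0" for z
  proof (cases "0 < ?h z")
    case True
    have "c * (v \<bullet> z) = - (w \<bullet> z)" using c by (simp add: v_def)
    then have "c * ln (?h z) \<le> c * (ln (?h 0) + v \<bullet> z)"
      using main[OF True] by (simp add: algebra_simps)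
    then have "ln (?h z) \<le> ln (?h 0) + v \<bullet> z" using c by simp
    then have "?h z \<le> exp (ln (?h 0) + v \<bullet> z)" using True by (metis exp_le_cancel_iff exp_ln)
    then have hz: "?h z \<le> ?h 0 * exp (v \<bullet> z)" using h0 by (simp add: exp_add)
    show ?thesis
    \<comment> \<open>The two exponential bounds can be multiplied only while
      \<open>1 - v \<bullet> z\<close> is nonnegative; past that the left side is at most 0.\<close>
    proof (cases "v \<bullet> z \<le> 1")
      case True
      have "1 - v \<bullet> z \<le> exp (- (v \<bullet> z))" using exp_ge_add_one_self[of "- (v \<bullet> z)"] by simp
      with hz True have "?h z * (1 - v \<bullet> z) \<le> (?h 0 * exp (v \<bullet> z)) * exp (- (v \<bullet> z))"
        using h0 by (intro mult_mono) auto
      also have "\<dots> = ?h 0" by (simp add: exp_minus)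
      finally show ?thesis .
    next
      case False
      then have "?h z * (1 - v \<bullet> z) \<le> 0" using True by (simp add: mult_le_0_iff)
      with h0 show ?thesis by simp
    qed
  next
    case False
    then have "?h z = 0" using fiber_volume_nonneg[of z] by simp
    with h0 show ?thesis by simp
  qed
  then show ?thesis by (rule that)
qed

end

section \<open>Total mass and first moments of the fiber volume\<close>

context positive_sublinear_pair
begin

text \<open>Equals the volume of the unit sublevel set times the inner product of \<open>v\<close>
  with its barycenter.\<close>

abbreviation moment_p :: "'a \<Rightarrow> real" where
  "moment_p v \<equiv> \<integral>x. indicator {x. p x \<le> 1} x * (v \<bullet> x) \<partial>lborel"

abbreviation moment_q :: "'a \<Rightarrow> real" where
  "moment_q v \<equiv> \<integral>x. indicator {x. q x \<le> 1} x * (v \<bullet> x) \<partial>lborel"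

text \<open>Meant for \<open>s = 1 - p x\<close> and \<open>a = 1 - v \<bullet> x\<close>: it then
  integrates the weight 1 - v . (x + y) over the slice of W above x.\<close>

lemma integral_affine_sublevel_q:
  assumes s: "0 \<le> s"
  shows "(\<integral>y. indicator {y. q y \<le> s} y * (a - v \<bullet> y) \<partial>lborel)
    = a * measure lborel {y. q y \<le> 1} * s ^ DIM('a) - moment_q v * s ^ Suc DIM('a)"
proof -
  have int: "integrable lborel (\<lambda>y. indicator {y. q y \<le> s} y * (v \<bullet> y))"
    "integrable lborel (\<lambda>y. indicator {y. q y \<le> s} y * (1::real))"
    by (rule q.integrable_sublevel, intro continuous_intros)+
  have "(\<integral>y. indicator {y. q y \<le> s} y * (a - v \<bullet> y) \<partial>lborel)
    = (\<integral>y. a * (indicator {y. q y \<le> s} y * 1) - indicator {y. q y \<le> s} y * (v \<bullet> y) \<partial>lborel)"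
    by (intro Bochner_Integration.integral_cong) (auto simp: algebra_simps)
  also have "\<dots> = a * (\<integral>y. indicator {y. q y \<le> s} y * 1 \<partial>lborel) - (\<integral>y. indicator {y. q y \<le> s} y * (v \<bullet> y) \<partial>lborel)"
    using int by (subst Bochner_Integration.integral_diff) auto
  also have "(\<integral>y. indicator {y. q y \<le> s} y * 1 \<partial>lborel) = s ^ (DIM('a) + 0) * (\<integral>y. indicator {y. q y \<le> 1} y * 1 \<partial>lborel)"
    by (intro q.integral_sublevel s) auto
  also have "(\<integral>y. indicator {y. q y \<le> s} y * (v \<bullet> y) \<partial>lborel) = s ^ (DIM('a) + 1) * moment_q v"
    by (intro q.integral_sublevel s) auto
  finally show ?thesis by simp
qed

text \<open>Two orders of integration of 1 - v . (x + y) over W: along the fibers of the sum it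
  gives the left side, along the slices above x it gives powers of \<open>1 - p x\<close>, whose
  integrals are known.\<close>

lemma integral_fiber_volume:
  fixes v :: 'a
  defines "n \<equiv> DIM('a)"
  shows "integrable lborel (\<lambda>z. fiber_volume z * (1 - v \<bullet> z))"
    and "(\<integral>z. fiber_volume z * (1 - v \<bullet> z) \<partial>lborel)
      = fact n * fact n / fact (n + n) * measure lborel {x. p x \<le> 1} * measure lborel {x. q x \<le> 1}
        - fact n * fact (Suc n) / fact (n + n + 1)
          * (measure lborel {x. q x \<le> 1} * moment_p v + measure lborel {x. p x \<le> 1} * moment_q v)"
proof -
  let ?A = "{x. p x \<le> 1}" and ?B = "{x. q x \<le> 1}"
  \<comment> \<open>W in the sheared coordinates (x + y, x), as a closed part of the image of the
    compact product of the two bodies.\<close>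
  define S where "S = {w :: 'a \<times> 'a. p (snd w) + q (fst w - snd w) \<le> 1}"
  define J where "J w = indicator S w * (1 - v \<bullet> fst w)" for w
  have "closed S"
    unfolding S_def
    by (intro closed_Collect_le continuous_intros p.continuous_compose q.continuous_compose)
  moreover have "S \<subseteq> (\<lambda>w. (fst w + snd w, fst w)) ` (?A \<times> ?B)"
  proof
    fix w assume "w \<in> S"
    then have "p (snd w) \<le> 1" "q (fst w - snd w) \<le> 1"
      using p.nonneg[of "snd w"] q.nonneg[of "fst w - snd w"] unfolding S_def mem_Collect_eq by linarith+
    then show "w \<in> (\<lambda>w. (fst w + snd w, fst w)) ` (?A \<times> ?B)"
      by (intro image_eqI[of _ _ "(snd w, fst w - snd w)"]) auto
  qed
  moreover have "compact ((\<lambda>w. (fst w + snd w, fst w)) ` (?A \<times> ?B))"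
    by (intro compact_continuous_image compact_Times p.compact_sublevel q.compact_sublevel continuous_intros)
  ultimately have "compact S"
    using compact_Int_closed[of "(\<lambda>w. (fst w + snd w, fst w)) ` (?A \<times> ?B)" S]
    by (simp only: inf.absorb2)
  then have "integrable lborel (\<lambda>w. indicator S w *\<^sub>R (1 - v \<bullet> fst w))"
    by (rule borel_integrable_compact) (intro continuous_intros)
  then have J: "integrable (lborel \<Otimes>\<^sub>M lborel) (case_prod (\<lambda>z x. J (z, x)))"
    by (simp add: J_def lborel_prod case_prod_unfold)
  have fib: "(\<integral>x. J (z, x) \<partial>lborel) = fiber_volume z * (1 - v \<bullet> z)" for z
  proof -
    have "(\<integral>x. J (z, x) \<partial>lborel) = (\<integral>x. indicator (fiber z) x * (1 - v \<bullet> z) \<partial>lborel)"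
      by (intro Bochner_Integration.integral_cong) (auto simp: J_def S_def fiber_def indicator_def)
    then show ?thesis
      using compact_fiber[of z] by (simp add: fiber_volume_def borel_compact)
  qed
  show "integrable lborel (\<lambda>z. fiber_volume z * (1 - v \<bullet> z))"
    using lborel_pair.integrable_fst'[OF J] by (simp add: fib)
  have Jm: "(\<lambda>z. J (z, x)) \<in> borel_measurable borel" for x
  proof -
    have "(\<lambda>z. J (z, x)) = (\<lambda>z. indicator {z. p x + q (z - x) \<le> 1} z * (1 - v \<bullet> z))"
      by (auto simp: J_def S_def indicator_def)
    moreover have "closed {z. p x + q (z - x) \<le> 1}"
      by (intro closed_Collect_le continuous_intros q.continuous_compose)
    then have "{z. p x + q (z - x) \<le> 1} \<in> sets borel" by (rule borel_closed)
    ultimately show ?thesis by simp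
  qed
  have inner: "(\<integral>z. J (z, x) \<partial>lborel) = 
      measure lborel ?B * (indicator ?A x * (1 * (1 - p x) ^ n)) 
      - measure lborel ?B * (indicator ?A x * ((v \<bullet> x) * (1 - p x) ^ n))
      - moment_q v * (indicator ?A x * (1 * (1 - p x) ^ Suc n))" for x
  proof (cases "p x \<le> 1")
    case True
    \<comment> \<open>Substituting z = x + y turns the section into the sublevel set of
      \<open>q\<close> at height \<open>1 - p x\<close>.\<close>
    have "(\<integral>z. J (z, x) \<partial>lborel) = (\<integral>y. J (x + y, x) \<partial>lborel)"
      by (rule lborel_integral_translate[OF Jm])
    also have "\<dots> = (\<integral>y. indicator {y. q y \<le> 1 - p x} y * ((1 - v \<bullet> x) - v \<bullet> y) \<partial>lborel)"
      by (intro Bochner_Integration.integral_cong) (auto simp: J_def S_def indicator_def inner_add_right)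
    also have "\<dots> = (1 - v \<bullet> x) * measure lborel ?B * (1 - p x) ^ n - moment_q v * (1 - p x) ^ Suc n"
      unfolding n_def using True by (intro integral_affine_sublevel_q) simp
    finally show ?thesis using True by (simp add: algebra_simps)
  next
    case False
    have "J (z, x) = 0" for z
  proof -
    have "\<not> p x + q (z - x) \<le> 1" using False q.nonneg[of "z - x"] by linarith
    then show ?thesis by (simp add: J_def S_def)
  qed
    then show ?thesis using False by simp
  qed
  have n: "0 < n" by (simp add: n_def)
  have i1: "(\<integral>x. indicator ?A x * (1 * (1 - p x) ^ n) \<partial>lborel) = fact n * fact n / fact (n + n) * measure lborel ?A"
    using p.integral_power_sublevel[of "\<lambda>_. 1" 0 n] n p.compact_sublevel[of 1] by (simp add: n_def borel_compact)
  have i2: "(\<integral>x. indicator ?A x * ((v \<bullet> x) * (1 - p x) ^ n) \<partial>lborel) = fact n * fact (Suc n) / fact (n + n + 1) * moment_p v"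
    using p.integral_power_sublevel[of "\<lambda>x. v \<bullet> x" 1 n] n by (simp add: n_def continuous_on_inner)
  \<comment> \<open>Exponent n + 1 with degree 0 gives the constant that exponent n with degree 1
    gives in \<open>i2\<close>, so the moments of both bodies share one factor.\<close>
  have i3: "(\<integral>x. indicator ?A x * (1 * (1 - p x) ^ Suc n) \<partial>lborel) = fact n * fact (Suc n) / fact (n + n + 1) * measure lborel ?A"
    using p.integral_power_sublevel[of "\<lambda>_. 1" 0 "Suc n"] p.compact_sublevel[of 1] by (simp add: n_def borel_compact mult_ac)
  have int: "integrable lborel (\<lambda>x. indicator ?A x * (1 * (1 - p x) ^ n))"
    "integrable lborel (\<lambda>x. indicator ?A x * ((v \<bullet> x) * (1 - p x) ^ n))"
    "integrable lborel (\<lambda>x. indicator ?A x * (1 * (1 - p x) ^ Suc n))"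
    by (rule p.integrable_sublevel, intro continuous_intros p.continuous_compose)+
  have "(\<integral>z. fiber_volume z * (1 - v \<bullet> z) \<partial>lborel) = (\<integral>z. (\<integral>x. J (z, x) \<partial>lborel) \<partial>lborel)"
    by (simp add: fib)
  also have "\<dots> = (\<integral>x. (\<integral>z. J (z, x) \<partial>lborel) \<partial>lborel)"
    by (rule lborel_pair.Fubini_integral[OF J, symmetric])
  also have "\<dots> = measure lborel ?B * (\<integral>x. indicator ?A x * (1 * (1 - p x) ^ n) \<partial>lborel)
      - measure lborel ?B * (\<integral>x. indicator ?A x * ((v \<bullet> x) * (1 - p x) ^ n) \<partial>lborel)
      - moment_q v * (\<integral>x. indicator ?A x * (1 * (1 - p x) ^ Suc n) \<partial>lborel)"
    unfolding inner
    by (subst Bochner_Integration.integral_diff Bochner_Integration.integral_diff;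
        (intro Bochner_Integration.integrable_diff integrable_mult_right int)?)+
       (simp only: integral_mult_right_zero)
  also have "\<dots> = fact n * fact n / fact (n + n) * measure lborel ?A * measure lborel ?B
        - fact n * fact (Suc n) / fact (n + n + 1)
          * (measure lborel ?B * moment_p v + measure lborel ?A * moment_q v)"
    unfolding i1 i2 i3 by (simp only: algebra_simps)
  finally show "(\<integral>z. fiber_volume z * (1 - v \<bullet> z) \<partial>lborel)
      = fact n * fact n / fact (n + n) * measure lborel ?A * measure lborel ?B
        - fact n * fact (Suc n) / fact (n + n + 1)
          * (measure lborel ?B * moment_p v + measure lborel ?A * moment_q v)" .
qed

text \<open>Fibers over points outside \<open>C\<close> are empty, so the tangent bound may be cut
  off to \<open>C\<close> before integrating. The premise \<open>bary\<close> ranges over all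
  directions because the tangent slope is known only to exist.\<close>

lemma fiber_volume_inequality:
  assumes C: "C \<in> sets borel" "emeasure lborel C < \<infinity>" 
    and sub: "\<And>x y. p x + q y \<le> 1 \<Longrightarrow> x + y \<in> C"
    and bary: "\<And>v. measure lborel {x. q x \<le> 1} * moment_p v + measure lborel {x. p x \<le> 1} * moment_q v = 0"
  shows "inverse (real ((2 * DIM('a)) choose DIM('a))) * (measure lborel {x. p x \<le> 1} * measure lborel {x. q x \<le> 1})
    \<le> measure lborel C * fiber_volume 0"
proof -
  obtain v where v: "\<And>z. fiber_volume z * (1 - v \<bullet> z) \<le> fiber_volume 0"
    by (rule fiber_volume_tangent) blast
  have "inverse (real ((2 * DIM('a)) choose DIM('a))) = fact DIM('a) * fact DIM('a) / fact (DIM('a) + DIM('a))"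
    by (simp add: binomial_fact mult_2)
  then have "inverse (real ((2 * DIM('a)) choose DIM('a))) * (measure lborel {x. p x \<le> 1} * measure lborel {x. q x \<le> 1})
    = (\<integral>z. fiber_volume z * (1 - v \<bullet> z) \<partial>lborel)"
    unfolding integral_fiber_volume(2) bary by simp
  also have "\<dots> \<le> (\<integral>z. fiber_volume 0 * indicator C z \<partial>lborel)"
  proof (rule integral_mono[OF integral_fiber_volume(1)])
    show "integrable lborel (\<lambda>z. fiber_volume 0 * indicator C z)" using C by simp
    show "fiber_volume z * (1 - v \<bullet> z) \<le> fiber_volume 0 * indicator C z" for z
    proof (cases "z \<in> C")
      case True
      then show ?thesis using v[of z] by simp
    next
      case False
      then have "fiber z = {}" using sub[of _ "z - _"] by (force simp: fiber_def)
      then show ?thesis using fiber_volume_nonneg[of 0] by (simp add: fiber_volume_def)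
    qed
  qed
  also have "\<dots> = measure lborel C * fiber_volume 0" using C by simp
  finally show ?thesis .
qed

end

section \<open>Support functions and polars\<close>

definition support_function :: "'a::euclidean_space set \<Rightarrow> 'a \<Rightarrow> real" where
  "support_function K x = (SUP y\<in>K. x \<bullet> y)"

lemma support_function_le_iff:
  assumes "compact K" "K \<noteq> {}"
  shows "support_function K x \<le> c \<longleftrightarrow> (\<forall>y\<in>K. x \<bullet> y \<le> c)"
proof -
  have "bdd_above ((\<lambda>y. x \<bullet> y) ` K)"
    using assms by (intro bounded_imp_bdd_above compact_imp_bounded compact_continuous_image continuous_intros)
  then show ?thesis
    unfolding support_function_def using assms by (subst cSUP_le_iff) auto
qed

lemma polar_eq_support_function:
  assumes "compact K" "K \<noteq> {}"
  shows "polar K = {x. support_function K x \<le> 1}"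
  using support_function_le_iff[OF assms] by (auto simp: polar_def)

lemma support_function_upper:
  assumes "compact K" "y \<in> K"
  shows "x \<bullet> y \<le> support_function K x"
  using support_function_le_iff[of K x "support_function K x"] assms by auto

lemma support_function_attained:
  assumes "compact K" "K \<noteq> {}"
  obtains y where "y \<in> K" "support_function K x = x \<bullet> y"
proof -
  obtain y where y: "y \<in> K" "\<And>z. z \<in> K \<Longrightarrow> x \<bullet> z \<le> x \<bullet> y"
    using continuous_attains_sup[OF assms continuous_on_inner[OF continuous_on_const continuous_on_id], of x] by auto
  then have "support_function K x = x \<bullet> y"
    using support_function_le_iff[OF assms, of x "x \<bullet> y"] support_function_upper[OF assms(1) y(1)]
    by (auto intro: antisym)
  with y(1) that show ?thesis by blast
qed

text \<open>A ball around 0 inside \<open>K\<close> gives the lower norm bound, a ball containing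
  \<open>K\<close> the upper one.\<close>

lemma positive_sublinear_support_function:
  assumes K: "compact K" "0 \<in> interior K"
  shows "positive_sublinear (support_function K)"
proof -
  have ne: "K \<noteq> {}" using K interior_subset by blast
  note le_iff = support_function_le_iff[OF K(1) ne]
  note upper = support_function_upper[OF K(1)]
  have sub: "support_function K (x + y) \<le> support_function K x + support_function K y" for x y
    unfolding le_iff by (auto simp: inner_add_left intro: add_mono upper)
  have hom: "support_function K (c *\<^sub>R x) = c * support_function K x" if c: "0 \<le> c" for c x
  proof (rule antisym)
    show "support_function K (c *\<^sub>R x) \<le> c * support_function K x"
      unfolding le_iff using c by (auto intro: mult_left_mono upper)
    obtain y where "y \<in> K" "support_function K x = x \<bullet> y"
      by (rule support_function_attained[OF K(1) ne])
    then show "c * support_function K x \<le> support_function K (c *\<^sub>R x)"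
      using upper[of y "c *\<^sub>R x"] by simp
  qed
  obtain r where r: "r > 0" "cball 0 r \<subseteq> K"
    using K(2) by (auto simp: mem_interior_cball)
  have low: "r * norm x \<le> support_function K x" for x
  proof (cases "x = 0")
    case True
    then show ?thesis using hom[of 0 0] by simp
  next
    case False
    have "(r / norm x) *\<^sub>R x \<in> cball 0 r" using r(1) False by simp
    with r(2) have "(r / norm x) *\<^sub>R x \<in> K" by blast
    from upper[OF this, of x] show ?thesis
      using False by (simp add: power2_norm_eq_inner[symmetric] power2_eq_square)
  qed
  obtain C where C: "\<And>y. y \<in> K \<Longrightarrow> norm y \<le> C"
    using compact_imp_bounded[OF K(1)] by (auto simp: bounded_iff)
  have up: "support_function K x \<le> C * norm x" for x
    unfolding le_iff
  proof
    fix y assume "y \<in> K"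
    have "x \<bullet> y \<le> norm x * norm y" by (rule norm_cauchy_schwarz)
    also have "\<dots> \<le> norm x * C" using C[OF \<open>y \<in> K\<close>] by (intro mult_left_mono) auto
    finally show "x \<bullet> y \<le> C * norm x" by (simp add: mult.commute)
  qed
  show ?thesis
    unfolding positive_sublinear_def using sub hom low up r(1) by blast
qed

section \<open>Volume and barycenter of the polar body\<close>

lemma compact_polar:
  assumes "compact K" "0 \<in> interior K"
  shows "compact (polar K)"
proof -
  interpret positive_sublinear_function "support_function K"
    by standard (rule positive_sublinear_support_function[OF assms])
  have "K \<noteq> {}" using assms interior_subset by blast
  then show ?thesis using compact_sublevel[of 1] assms by (simp add: polar_eq_support_function)
qed

text \<open>If the ball of radius \<open>C\<close> contains \<open>K\<close>, the polar contains the
  ball of radius \<open>1 / C\<close>. Positivity undoes the division in \<open>barycenter\<close>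
  and later cancels a common factor.\<close>

lemma measure_polar_pos:
  assumes "compact K" "0 \<in> interior K"
  shows "0 < measure lebesgue (polar K)"
proof -
  obtain C where C: "C > 0" "\<And>y. y \<in> K \<Longrightarrow> norm y \<le> C"
    using compact_imp_bounded[OF assms(1)] by (auto simp: bounded_pos)
  have "ball 0 (1 / C) \<subseteq> polar K"
  proof
    fix x :: 'a assume "x \<in> ball 0 (1 / C)"
    then have x: "norm x \<le> 1 / C" by simp
    have "x \<bullet> y \<le> 1" if "y \<in> K" for y
    proof -
      have "x \<bullet> y \<le> norm x * norm y" by (rule norm_cauchy_schwarz)
      also have "\<dots> \<le> (1 / C) * C" using x C(1) C(2)[OF that] by (intro mult_mono) auto
      finally show ?thesis using C by simp
    qed
    then show "x \<in> polar K" by (simp add: polar_def)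
  qed
  then have "measure lebesgue (ball (0::'a) (1 / C)) \<le> measure lebesgue (polar K)"
    by (intro measure_mono_fmeasurable lmeasurable_compact compact_polar assms) auto
  moreover have "0 < measure lebesgue (ball (0::'a) (1 / C))"
    using content_ball_pos[of "1 / C" 0] C by simp
  ultimately show ?thesis by linarith
qed

text \<open>Clears the denominator of \<open>barycenter\<close> and passes from
  \<open>lebesgue\<close> to \<open>lborel\<close>, where the moments are computed.\<close>

lemma inner_barycenter:
  fixes A :: "'a::euclidean_space set"
  assumes "compact A" "0 < measure lebesgue A"
  shows "measure lborel A * (v \<bullet> barycenter A) = (\<integral>x. indicator A x * (v \<bullet> x) \<partial>lborel)"
proof -
  have [measurable]: "A \<in> sets borel" using assms by (simp add: borel_compact)
  have int: "integrable lborel (\<lambda>x. indicator A x *\<^sub>R x)"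
    using assms by (intro borel_integrable_compact continuous_intros)
  have "(LINT x:A|lebesgue. x) = (\<integral>x. indicator A x *\<^sub>R x \<partial>lborel)"
    unfolding set_lebesgue_integral_def by (rule integral_completion) measurable
  then have "measure lborel A *\<^sub>R barycenter A = (\<integral>x. indicator A x *\<^sub>R x \<partial>lborel)"
    using assms(2) by (simp add: barycenter_def)
  then have "measure lborel A * (v \<bullet> barycenter A) = v \<bullet> (\<integral>x. indicator A x *\<^sub>R x \<partial>lborel)"
    by (metis inner_scaleR_right)
  also have "\<dots> = (\<integral>x. v \<bullet> (indicator A x *\<^sub>R x) \<partial>lborel)"
    by (rule integral_inner_right[symmetric]) (rule int)
  finally show ?thesis by simp
qed

lemma polar_volume_inequality:
  fixes K L :: "'a::euclidean_space set"
  assumes K: "compact K" "0 \<in> interior K" and L: "compact L" "0 \<in> interior L"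
    and bary: "barycenter (polar K) = - barycenter (polar L)"
  shows "inverse (real ((2 * DIM('a)) choose DIM('a))) * (measure lebesgue (polar K) * measure lebesgue (polar L))
    \<le> measure lebesgue (polar (K \<inter> L)) * measure lebesgue (polar (minkowski_diff K L))"
proof -
  define p q where "p = support_function K" and "q = support_function L"
  interpret positive_sublinear_pair p q
    by standard (simp_all add: p_def q_def positive_sublinear_support_function K L)
  have ne: "K \<noteq> {}" "L \<noteq> {}" using K L interior_subset by blast+
  have pol: "polar K = {x. p x \<le> 1}" "polar L = {x. q x \<le> 1}"
    using K L ne by (simp_all add: p_def q_def polar_eq_support_function)
  \<comment> \<open>\<open>p x + q (- x)\<close> is the support function of K - L at x: two
    maximizers, one in \<open>K\<close> and one in \<open>L\<close>, attain it at their
    difference.\<close>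
  have "polar (minkowski_diff K L) = fiber 0"
  proof (intro set_eqI iffI)
    fix x assume x: "x \<in> polar (minkowski_diff K L)"
    obtain y where y: "y \<in> K" "p x = x \<bullet> y"
      unfolding p_def by (rule support_function_attained[OF K(1) ne(1)])
    obtain z where z: "z \<in> L" "q (- x) = - x \<bullet> z"
      unfolding q_def by (rule support_function_attained[OF L(1) ne(2)])
    have "y - z \<in> minkowski_diff K L" using y z by (auto simp: minkowski_diff_def)
    with x have "x \<bullet> (y - z) \<le> 1" by (auto simp: polar_def)
    with y z show "x \<in> fiber 0" by (simp add: fiber_def inner_diff_right)
  next
    fix x assume x: "x \<in> fiber 0"
    show "x \<in> polar (minkowski_diff K L)"
      unfolding polar_def
    proof safe
      fix w assume "w \<in> minkowski_diff K L"
      then obtain y z where w: "w = y - z" "y \<in> K" "z \<in> L" by (auto simp: minkowski_diff_def)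
      have "x \<bullet> y \<le> p x" "- x \<bullet> z \<le> q (- x)"
        using w by (simp_all only: p_def q_def support_function_upper K(1) L(1))
      with x show "x \<bullet> w \<le> 1" by (simp add: fiber_def w inner_diff_right)
    qed
  qed
  then have diff: "measure lebesgue (polar (minkowski_diff K L)) = fiber_volume 0"
    using compact_fiber[of 0] by (simp add: fiber_volume_def borel_compact)
  have cpt: "compact (polar K)" "compact (polar L)" "compact (polar (K \<inter> L))"
    using K L by (auto intro!: compact_polar)
  have pos: "0 < measure lebesgue (polar K)" "0 < measure lebesgue (polar L)"
    using K L by (auto intro: measure_polar_pos)
  have leb: "measure lebesgue A = measure lborel A" if "compact A" for A :: "'a set"
    using that by (simp add: borel_compact)
  have "inverse (real ((2 * DIM('a)) choose DIM('a))) * (measure lborel {x. p x \<le> 1} * measure lborel {x. q x \<le> 1})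
    \<le> measure lborel (polar (K \<inter> L)) * fiber_volume 0"
  proof (rule fiber_volume_inequality)
    show "polar (K \<inter> L) \<in> sets borel" using cpt by (simp add: borel_compact)
    show "emeasure lborel (polar (K \<inter> L)) < \<infinity>"
      using cpt by (intro emeasure_bounded_finite compact_imp_bounded)
    show "x + y \<in> polar (K \<inter> L)" if "p x + q y \<le> 1" for x y
      unfolding polar_def
    proof safe
      fix w assume "w \<in> K" "w \<in> L"
      then have "x \<bullet> w \<le> p x" "y \<bullet> w \<le> q y"
        by (simp_all only: p_def q_def support_function_upper K(1) L(1))
      with that show "(x + y) \<bullet> w \<le> 1" by (simp add: inner_add_left)
    qed
    \<comment> \<open>With denominators cleared, both terms carry the product of the two volumes, so
      opposite barycenters cancel.\<close>
    show "measure lborel {x. q x \<le> 1} * moment_p v + measure lborel {x. p x \<le> 1} * moment_q v = 0" for v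
      unfolding pol[symmetric] inner_barycenter[OF cpt(1) pos(1), symmetric]
        inner_barycenter[OF cpt(2) pos(2), symmetric] bary
      by simp
  qed
  then show ?thesis using leb cpt by (simp add: pol diff)
qed

theorem corollary1p3:
  shows "(\<forall>K L :: (real ^ 'n) set.
            convex_body K \<longrightarrow> convex_body L \<longrightarrow> 0 \<in> interior K \<inter> interior L \<longrightarrow>
            barycenter (polar K) = - barycenter (polar L) \<longrightarrow>
            measure lebesgue (polar (K \<inter> L)) * measure lebesgue (polar (minkowski_diff K L))
              \<ge> inverse (real ((2 * CARD('n)) choose CARD('n)))
                  * (measure lebesgue (polar K) * measure lebesgue (polar L)))
       \<and> (\<forall>K :: (real ^ 'n) set.
            convex_body K \<longrightarrow> 0 \<in> interior K \<longrightarrow> barycenter (polar K) = 0 \<longrightarrow>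
            measure lebesgue (polar (minkowski_diff K K))
              \<ge> inverse (real ((2 * CARD('n)) choose CARD('n))) * measure lebesgue (polar K))"
proof (intro conjI allI impI)
  fix K L :: "(real ^ 'n) set"
  assume "convex_body K" "convex_body L" "0 \<in> interior K \<inter> interior L"
    and "barycenter (polar K) = - barycenter (polar L)"
  then show "measure lebesgue (polar (K \<inter> L)) * measure lebesgue (polar (minkowski_diff K L))
      \<ge> inverse (real ((2 * CARD('n)) choose CARD('n)))
          * (measure lebesgue (polar K) * measure lebesgue (polar L))"
    using polar_volume_inequality[of K L] by (simp add: convex_body_def)
next
  fix K :: "(real ^ 'n) set"
  assume "convex_body K" and K0: "0 \<in> interior K" and bary: "barycenter (polar K) = 0"
  then have K: "compact K" by (simp add: convex_body_def)
  let ?c = "inverse (real ((2 * CARD('n)) choose CARD('n)))"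
  \<comment> \<open>For L = K the intersection is \<open>K\<close> again, so the positive volume of
    its polar stands on both sides and cancels.\<close>
  have "measure lebesgue (polar K) * (?c * measure lebesgue (polar K))
    \<le> measure lebesgue (polar K) * measure lebesgue (polar (minkowski_diff K K))"
    using polar_volume_inequality[OF K K0 K K0] bary by (simp add: mult_ac)
  then show "measure lebesgue (polar (minkowski_diff K K)) \<ge> ?c * measure lebesgue (polar K)"
    using measure_polar_pos[OF K K0] by (rule mult_left_le_imp_le)
qed

end
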